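(* Let $(\mathsf{C},\otimes,\mathbb{1})$ be a monoidal category having all coreflexive equalisers, and let $\mathsf{D}$ be a category enriched, tensored and cotensored over $\mathsf{C}$ having all coreflexive equalisers and all reflexive coequalisers. Let $Q$ be a Hopf comonad on $\mathsf{C}$ that preserves coreflexive equalisers and let $R$ be a comonad on $\mathsf{D}$ that preserves coreflexive equalisers. Given a tensorisation $$\mathsf{Cog}_{\mathsf{C}}(Q)\times\mathsf{Cog}_{\mathsf{D}}(R)\to\mathsf{Cog}_{\mathsf{D}}(R)$$ of $R$-coalgebras over the monoidal category of $Q$-coalgebras that lifts the tensorisation of $\mathsf{D}$ by $\mathsf{C}$, the category of $R$-coalgebras is enriched, tensored and cotensored over the monoidal category of $Q$-coalgebras (with the given tensorisation).
   Context: For a comonad $Q$ on $\mathsf{C}$, $\mathsf{Cog}_{\mathsf{C}}(Q)$ denotes the category of $Q$-coalgebras. A Hopf comonad on a monoidal category $(\mathsf{C},\otimes,\mathbb{1})$ is a comonad $(Q,w,n)$ together with a lax monoidal structure $Q(X)\otimes Q(Y)\to Q(X\otimes Y)$, $\mathbb{1}\to Q(\mathbb{1})$ on $Q$ such that $w:Q\to QQ$ and $n:Q\to\mathrm{Id}$ are monoidal natural transformations. Then $\mathsf{Cog}_{\mathsf{C}}(Q)$ is a monoidal category whose forgetful functor to $\mathsf{C}$ is strict monoidal: the coaction on $V\otimes W$ is $V\otimes W\to Q(V)\otimes Q(W)\to Q(V\otimes W)$ and that on $\mathbb{1}$ is $\mathbb{1}\to Q(\mathbb{1})$. A tensorisation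 of a category $\mathsf{D}$ by a monoidal category $\mathsf{E}$ is a bifunctor $-\boxtimes-:\mathsf{E}\times\mathsf{D}\to\mathsf{D}$ with natural transformations $\mathbb{1}\boxtimes X\to X$ and $(V'\otimes V)\boxtimes X\to V'\boxtimes(V\boxtimes X)$ (not required to be invertible) satisfying the usual associativity and unit coherences; equivalently, an oplax monoidal functor $\mathsf{E}\to\mathrm{Fun}(\mathsf{D},\mathsf{D})$. A category $\mathsf{D}$ is enriched, tensored and cotensored over $\mathsf{E}$ if it is equipped with bifunctors $-\boxtimes-:\mathsf{E}\times\mathsf{D}\to\mathsf{D}$, $\{-,-\}:\mathsf{D}^{op}\times\mathsf{D}\to\mathsf{E}$, $\langle-,-\rangle:\mathsf{D}\times\mathsf{E}^{op}\to\mathsf{D}$, natural isomorphisms $$\hom_{\mathsf{D}}(V\boxtimes X,Y)\simeq\hom_{\mathsf{E}}(V,\{X,Y\})\simeq\hom_{\mathsf{D}}(X,\langle Y,V\rangle),$$ and a structure of tensorisation on $\boxtimes$ (equivalently, through the adjunctions, a structure of enrichment on $\{-,-\}$, i.e. unital associative compositions $\{Y,Z\}\otimes\{X,Y\}\to\{X,Z\}$, $\mathbb{1}\to\{X,X\}$; or a structure of cotensorisation on $\langle-,-\rangle$, i.e. coherent natural maps $X\to\langle X,\mathbb{1}\rangle$, $\langle\langle X,V\rangle,V'\rangle\to\langle X,V\otimes V'\rangle$). A tensorisation of $R$-coalgebras by $Q$-coalgebras lifts that of $\mathsf{D}$ by $\mathsf{C}$ if the forgetful functors commute strictly with the bifunctors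 $\boxtimes$ and send the structural natural transformations to those of the tensorisation of $\mathsf{D}$ by $\mathsf{C}$. A coreflexive equaliser is an equaliser of a parallel pair with a common left inverse (retraction); a reflexive coequaliser is a coequaliser of a parallel pair with a common right inverse (section). *)

theory Defs
  imports Main
begin

section \<open>Categories\<close>

record ('o, 'm) cat =
  Obj :: "'o set"
  Arr :: "'m set"
  Dom :: "'m \<Rightarrow> 'o"
  Cod :: "'m \<Rightarrow> 'o"
  Ident :: "'o \<Rightarrow> 'm"
  Comp :: "'m \<Rightarrow> 'm \<Rightarrow> 'm" (infixr "\<cdot>\<index>" 65)

definition hom :: "('o, 'm, 'x) cat_scheme \<Rightarrow> 'o \<Rightarrow> 'o \<Rightarrow> 'm set" where
  "hom C X Y = {f \<in> Arr C. Dom C f = X \<and> Cod C f = Y}"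

locale category =
  fixes C :: "('o, 'm, 'x) cat_scheme" (structure)
  assumes Dom_in: "f \<in> Arr C \<Longrightarrow> Dom C f \<in> Obj C"
    and Cod_in: "f \<in> Arr C \<Longrightarrow> Cod C f \<in> Obj C"
    and Ident_in: "X \<in> Obj C \<Longrightarrow> Ident C X \<in> hom C X X"
    and Comp_in: "\<lbrakk>f \<in> hom C X Y; g \<in> hom C Y Z\<rbrakk> \<Longrightarrow> g \<cdot> f \<in> hom C X Z"
    and Ident_left: "f \<in> hom C X Y \<Longrightarrow> Ident C Y \<cdot> f = f"
    and Ident_right: "f \<in> hom C X Y \<Longrightarrow> f \<cdot> Ident C X = f"
    and Comp_assoc: "\<lbrakk>f \<in> hom C W X; g \<in> hom C X Y; h \<in> hom C Y Z\<rbrakk>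
      \<Longrightarrow> (h \<cdot> g) \<cdot> f = h \<cdot> (g \<cdot> f)"

definition is_iso :: "('o, 'm, 'x) cat_scheme \<Rightarrow> 'm \<Rightarrow> bool" where
  "is_iso C f \<longleftrightarrow> f \<in> Arr C \<and>
     (\<exists>g \<in> hom C (Cod C f) (Dom C f).
        g \<cdot>\<^bsub>C\<^esub> f = Ident C (Dom C f) \<and> f \<cdot>\<^bsub>C\<^esub> g = Ident C (Cod C f))"

definition op_cat :: "('o, 'm, 'x) cat_scheme \<Rightarrow> ('o, 'm) cat" where
  "op_cat C = \<lparr>Obj = Obj C, Arr = Arr C, Dom = Cod C, Cod = Dom C, Ident = Ident C,
     Comp = (\<lambda>g f. f \<cdot>\<^bsub>C\<^esub> g)\<rparr>"

definition prod_cat ::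
  "('o, 'm, 'x) cat_scheme \<Rightarrow> ('p, 'n, 'y) cat_scheme \<Rightarrow> ('o \<times> 'p, 'm \<times> 'n) cat" where
  "prod_cat C D = \<lparr>Obj = Obj C \<times> Obj D, Arr = Arr C \<times> Arr D,
     Dom = map_prod (Dom C) (Dom D), Cod = map_prod (Cod C) (Cod D),
     Ident = map_prod (Ident C) (Ident D),
     Comp = (\<lambda>(g, g') (f, f'). (g \<cdot>\<^bsub>C\<^esub> f, g' \<cdot>\<^bsub>D\<^esub> f'))\<rparr>"


section \<open>Functors and natural transformations\<close>

record ('o, 'm, 'p, 'n) func =
  ob :: "'o \<Rightarrow> 'p"
  ar :: "'m \<Rightarrow> 'n"

locale cat_functor =
  source: category C + target: category D
  for C :: "('o, 'm, 'x) cat_scheme" and D :: "('p, 'n, 'y) cat_scheme" +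
  fixes F :: "('o, 'm, 'p, 'n, 'z) func_scheme"
  assumes ob_in: "X \<in> Obj C \<Longrightarrow> ob F X \<in> Obj D"
    and ar_in: "f \<in> hom C X Y \<Longrightarrow> ar F f \<in> hom D (ob F X) (ob F Y)"
    and ar_Ident: "X \<in> Obj C \<Longrightarrow> ar F (Ident C X) = Ident D (ob F X)"
    and ar_Comp: "\<lbrakk>f \<in> hom C X Y; g \<in> hom C Y Z\<rbrakk>
      \<Longrightarrow> ar F (g \<cdot>\<^bsub>C\<^esub> f) = ar F g \<cdot>\<^bsub>D\<^esub> ar F f"

definition id_func :: "('o, 'm, 'o, 'm) func" where
  "id_func = \<lparr>ob = (\<lambda>X. X), ar = (\<lambda>f. f)\<rparr>"

definition comp_func ::
  "('p, 'n, 'q, 'k, 'z) func_scheme \<Rightarrow> ('o, 'm, 'p, 'n, 'w) func_scheme \<Rightarrow> ('o, 'm, 'q, 'k) func"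
  where "comp_func G F = \<lparr>ob = (\<lambda>X. ob G (ob F X)), ar = (\<lambda>f. ar G (ar F f))\<rparr>"

locale nat_trans =
  dom_functor: cat_functor C D F + cod_functor: cat_functor C D G
  for C :: "('o, 'm, 'x) cat_scheme" and D :: "('p, 'n, 'y) cat_scheme"
    and F :: "('o, 'm, 'p, 'n, 'z) func_scheme" and G :: "('o, 'm, 'p, 'n, 'w) func_scheme" +
  fixes \<tau> :: "'o \<Rightarrow> 'n"
  assumes component_in: "X \<in> Obj C \<Longrightarrow> \<tau> X \<in> hom D (ob F X) (ob G X)"
    and natural: "f \<in> hom C X Y \<Longrightarrow> \<tau> Y \<cdot>\<^bsub>D\<^esub> ar F f = ar G f \<cdot>\<^bsub>D\<^esub> \<tau> X"


section \<open>Coreflexive equalisers and reflexive coequalisers\<close>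

definition parallel :: "('o, 'm, 'x) cat_scheme \<Rightarrow> 'm \<Rightarrow> 'm \<Rightarrow> bool" where
  "parallel C f g \<longleftrightarrow> f \<in> Arr C \<and> g \<in> Arr C \<and> Dom C f = Dom C g \<and> Cod C f = Cod C g"

definition coreflexive_pair :: "('o, 'm, 'x) cat_scheme \<Rightarrow> 'm \<Rightarrow> 'm \<Rightarrow> bool" where
  "coreflexive_pair C f g \<longleftrightarrow> parallel C f g \<and>
     (\<exists>r \<in> hom C (Cod C f) (Dom C f).
        r \<cdot>\<^bsub>C\<^esub> f = Ident C (Dom C f) \<and> r \<cdot>\<^bsub>C\<^esub> g = Ident C (Dom C f))"

definition reflexive_pair :: "('o, 'm, 'x) cat_scheme \<Rightarrow> 'm \<Rightarrow> 'm \<Rightarrow> bool" where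
  "reflexive_pair C f g \<longleftrightarrow> parallel C f g \<and>
     (\<exists>s \<in> hom C (Cod C f) (Dom C f).
        f \<cdot>\<^bsub>C\<^esub> s = Ident C (Cod C f) \<and> g \<cdot>\<^bsub>C\<^esub> s = Ident C (Cod C f))"

definition is_equaliser :: "('o, 'm, 'x) cat_scheme \<Rightarrow> 'm \<Rightarrow> 'm \<Rightarrow> 'm \<Rightarrow> bool" where
  "is_equaliser C f g e \<longleftrightarrow> parallel C f g \<and> e \<in> Arr C \<and> Cod C e = Dom C f \<and>
     f \<cdot>\<^bsub>C\<^esub> e = g \<cdot>\<^bsub>C\<^esub> e \<and>
     (\<forall>h \<in> Arr C. Cod C h = Dom C f \<and> f \<cdot>\<^bsub>C\<^esub> h = g \<cdot>\<^bsub>C\<^esub> h \<longrightarrow>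
        (\<exists>!k. k \<in> hom C (Dom C h) (Dom C e) \<and> e \<cdot>\<^bsub>C\<^esub> k = h))"

definition is_coequaliser :: "('o, 'm, 'x) cat_scheme \<Rightarrow> 'm \<Rightarrow> 'm \<Rightarrow> 'm \<Rightarrow> bool" where
  "is_coequaliser C f g e \<longleftrightarrow> parallel C f g \<and> e \<in> Arr C \<and> Dom C e = Cod C f \<and>
     e \<cdot>\<^bsub>C\<^esub> f = e \<cdot>\<^bsub>C\<^esub> g \<and>
     (\<forall>h \<in> Arr C. Dom C h = Cod C f \<and> h \<cdot>\<^bsub>C\<^esub> f = h \<cdot>\<^bsub>C\<^esub> g \<longrightarrow>
        (\<exists>!k. k \<in> hom C (Cod C e) (Cod C h) \<and> k \<cdot>\<^bsub>C\<^esub> e = h))"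

definition has_coreflexive_equalisers :: "('o, 'm, 'x) cat_scheme \<Rightarrow> bool" where
  "has_coreflexive_equalisers C \<longleftrightarrow>
     (\<forall>f g. coreflexive_pair C f g \<longrightarrow> (\<exists>e. is_equaliser C f g e))"

definition has_reflexive_coequalisers :: "('o, 'm, 'x) cat_scheme \<Rightarrow> bool" where
  "has_reflexive_coequalisers C \<longleftrightarrow>
     (\<forall>f g. reflexive_pair C f g \<longrightarrow> (\<exists>e. is_coequaliser C f g e))"

definition preserves_coreflexive_equalisers ::
  "('o, 'm, 'x) cat_scheme \<Rightarrow> ('p, 'n, 'y) cat_scheme \<Rightarrow> ('o, 'm, 'p, 'n, 'z) func_scheme \<Rightarrow> bool"
  where
  "preserves_coreflexive_equalisers C D F \<longleftrightarrow>
     (\<forall>f g e. coreflexive_pair C f g \<and> is_equaliser C f g e \<longrightarrow>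
        is_equaliser D (ar F f) (ar F g) (ar F e))"


section \<open>Monoidal categories and lax monoidal functors\<close>

record ('o, 'm) moncat = "('o, 'm) cat" +
  tensor :: "('o \<times> 'o, 'm \<times> 'm, 'o, 'm) func"
  unit :: "'o"
  assoc :: "'o \<Rightarrow> 'o \<Rightarrow> 'o \<Rightarrow> 'm"
  lunit :: "'o \<Rightarrow> 'm"
  runit :: "'o \<Rightarrow> 'm"

abbreviation tensor_ob :: "'o \<Rightarrow> ('o, 'm, 'x) moncat_scheme \<Rightarrow> 'o \<Rightarrow> 'o"
    ("(_ \<otimes>\<^bsub>_\<^esub> _)" [71, 0, 70] 70) where
  "X \<otimes>\<^bsub>C\<^esub> Y \<equiv> ob (tensor C) (X, Y)"

abbreviation tensor_ar :: "'m \<Rightarrow> ('o, 'm, 'x) moncat_scheme \<Rightarrow> 'm \<Rightarrow> 'm"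
    ("(_ \<odot>\<^bsub>_\<^esub> _)" [71, 0, 70] 70) where
  "f \<odot>\<^bsub>C\<^esub> g \<equiv> ar (tensor C) (f, g)"

locale monoidal_category =
  category C + tensor: cat_functor "prod_cat C C" C "tensor C"
  for C :: "('o, 'm, 'x) moncat_scheme" (structure) +
  assumes unit_in: "unit C \<in> Obj C"
    and assoc_in: "\<lbrakk>X \<in> Obj C; Y \<in> Obj C; Z \<in> Obj C\<rbrakk>
      \<Longrightarrow> assoc C X Y Z \<in> hom C ((X \<otimes>\<^bsub>C\<^esub> Y) \<otimes>\<^bsub>C\<^esub> Z) (X \<otimes>\<^bsub>C\<^esub> (Y \<otimes>\<^bsub>C\<^esub> Z))"
    and lunit_in: "X \<in> Obj C \<Longrightarrow> lunit C X \<in> hom C (unit C \<otimes>\<^bsub>C\<^esub> X) X"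
    and runit_in: "X \<in> Obj C \<Longrightarrow> runit C X \<in> hom C (X \<otimes>\<^bsub>C\<^esub> unit C) X"
    and assoc_iso: "\<lbrakk>X \<in> Obj C; Y \<in> Obj C; Z \<in> Obj C\<rbrakk> \<Longrightarrow> is_iso C (assoc C X Y Z)"
    and lunit_iso: "X \<in> Obj C \<Longrightarrow> is_iso C (lunit C X)"
    and runit_iso: "X \<in> Obj C \<Longrightarrow> is_iso C (runit C X)"
    and assoc_natural:
      "\<lbrakk>f \<in> hom C X X'; g \<in> hom C Y Y'; h \<in> hom C Z Z'\<rbrakk>
        \<Longrightarrow> assoc C X' Y' Z' \<cdot> ((f \<odot>\<^bsub>C\<^esub> g) \<odot>\<^bsub>C\<^esub> h) = (f \<odot>\<^bsub>C\<^esub> (g \<odot>\<^bsub>C\<^esub> h)) \<cdot> assoc C X Y Z"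
    and lunit_natural:
      "f \<in> hom C X X' \<Longrightarrow> lunit C X' \<cdot> (Ident C (unit C) \<odot>\<^bsub>C\<^esub> f) = f \<cdot> lunit C X"
    and runit_natural:
      "f \<in> hom C X X' \<Longrightarrow> runit C X' \<cdot> (f \<odot>\<^bsub>C\<^esub> Ident C (unit C)) = f \<cdot> runit C X"
    and pentagon:
      "\<lbrakk>W \<in> Obj C; X \<in> Obj C; Y \<in> Obj C; Z \<in> Obj C\<rbrakk>
        \<Longrightarrow> assoc C W X (Y \<otimes>\<^bsub>C\<^esub> Z) \<cdot> assoc C (W \<otimes>\<^bsub>C\<^esub> X) Y Z
          = (Ident C W \<odot>\<^bsub>C\<^esub> assoc C X Y Z) \<cdot> assoc C W (X \<otimes>\<^bsub>C\<^esub> Y) Z \<cdot> (assoc C W X Y \<odot>\<^bsub>C\<^esub> Ident C Z)"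
    and triangle:
      "\<lbrakk>X \<in> Obj C; Y \<in> Obj C\<rbrakk>
        \<Longrightarrow> (Ident C X \<odot>\<^bsub>C\<^esub> lunit C Y) \<cdot> assoc C X (unit C) Y = runit C X \<odot>\<^bsub>C\<^esub> Ident C Y"

locale lax_monoidal_functor =
  source_mon: monoidal_category C + target_mon: monoidal_category D + cat_functor C D F
  for C :: "('o, 'm, 'x) moncat_scheme" and D :: "('p, 'n, 'y) moncat_scheme"
    and F :: "('o, 'm, 'p, 'n, 'z) func_scheme" +
  fixes \<mu> :: "'o \<Rightarrow> 'o \<Rightarrow> 'n" and \<eta> :: 'n
  assumes mult_in: "\<lbrakk>X \<in> Obj C; Y \<in> Obj C\<rbrakk>
      \<Longrightarrow> \<mu> X Y \<in> hom D (ob F X \<otimes>\<^bsub>D\<^esub> ob F Y) (ob F (X \<otimes>\<^bsub>C\<^esub> Y))"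
    and unit_map_in: "\<eta> \<in> hom D (unit D) (ob F (unit C))"
    and mult_natural: "\<lbrakk>f \<in> hom C X X'; g \<in> hom C Y Y'\<rbrakk>
      \<Longrightarrow> \<mu> X' Y' \<cdot>\<^bsub>D\<^esub> (ar F f \<odot>\<^bsub>D\<^esub> ar F g) = ar F (f \<odot>\<^bsub>C\<^esub> g) \<cdot>\<^bsub>D\<^esub> \<mu> X Y"
    and mult_assoc: "\<lbrakk>X \<in> Obj C; Y \<in> Obj C; Z \<in> Obj C\<rbrakk>
      \<Longrightarrow> ar F (assoc C X Y Z) \<cdot>\<^bsub>D\<^esub> \<mu> (X \<otimes>\<^bsub>C\<^esub> Y) Z \<cdot>\<^bsub>D\<^esub> (\<mu> X Y \<odot>\<^bsub>D\<^esub> Ident D (ob F Z))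
        = \<mu> X (Y \<otimes>\<^bsub>C\<^esub> Z) \<cdot>\<^bsub>D\<^esub> (Ident D (ob F X) \<odot>\<^bsub>D\<^esub> \<mu> Y Z) \<cdot>\<^bsub>D\<^esub> assoc D (ob F X) (ob F Y) (ob F Z)"
    and mult_lunit: "X \<in> Obj C
      \<Longrightarrow> ar F (lunit C X) \<cdot>\<^bsub>D\<^esub> \<mu> (unit C) X \<cdot>\<^bsub>D\<^esub> (\<eta> \<odot>\<^bsub>D\<^esub> Ident D (ob F X)) = lunit D (ob F X)"
    and mult_runit: "X \<in> Obj C
      \<Longrightarrow> ar F (runit C X) \<cdot>\<^bsub>D\<^esub> \<mu> X (unit C) \<cdot>\<^bsub>D\<^esub> (Ident D (ob F X) \<odot>\<^bsub>D\<^esub> \<eta>) = runit D (ob F X)"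

locale monoidal_nat_trans =
  dom_lax: lax_monoidal_functor C D F \<mu> \<eta> + cod_lax: lax_monoidal_functor C D G \<mu>' \<eta>' +
  nat_trans C D F G \<tau>
  for C :: "('o, 'm, 'x) moncat_scheme" and D :: "('p, 'n, 'y) moncat_scheme"
    and F :: "('o, 'm, 'p, 'n, 'z) func_scheme" and \<mu> \<eta>
    and G :: "('o, 'm, 'p, 'n, 'w) func_scheme" and \<mu>' \<eta>' and \<tau> +
  assumes monoidal_mult: "\<lbrakk>X \<in> Obj C; Y \<in> Obj C\<rbrakk>
      \<Longrightarrow> \<tau> (X \<otimes>\<^bsub>C\<^esub> Y) \<cdot>\<^bsub>D\<^esub> \<mu> X Y = \<mu>' X Y \<cdot>\<^bsub>D\<^esub> (\<tau> X \<odot>\<^bsub>D\<^esub> \<tau> Y)"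
    and monoidal_unit: "\<tau> (unit C) \<cdot>\<^bsub>D\<^esub> \<eta> = \<eta>'"


section \<open>Comonads, Hopf comonads and their coalgebras\<close>

record ('o, 'm) comnd = "('o, 'm, 'o, 'm) func" +
  comult :: "'o \<Rightarrow> 'm"
  counit :: "'o \<Rightarrow> 'm"

record ('o, 'm) hopf_comnd = "('o, 'm) comnd" +
  lax_mult :: "'o \<Rightarrow> 'o \<Rightarrow> 'm"
  lax_unit :: "'m"

locale comonad =
  cat_functor C C Q +
  comult: nat_trans C C Q "comp_func Q Q" "comult Q" +
  counit: nat_trans C C Q id_func "counit Q"
  for C :: "('o, 'm, 'x) cat_scheme" (structure) and Q :: "('o, 'm, 'y) comnd_scheme" +
  assumes coassoc: "X \<in> Obj C
      \<Longrightarrow> comult Q (ob Q X) \<cdot> comult Q X = ar Q (comult Q X) \<cdot> comult Q X"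
    and counit_left: "X \<in> Obj C \<Longrightarrow> counit Q (ob Q X) \<cdot> comult Q X = Ident C (ob Q X)"
    and counit_right: "X \<in> Obj C \<Longrightarrow> ar Q (counit Q X) \<cdot> comult Q X = Ident C (ob Q X)"

locale hopf_comonad =
  comonad C Q +
  lax_monoidal_functor C C Q "lax_mult Q" "lax_unit Q" +
  comult_mon: monoidal_nat_trans C C Q "lax_mult Q" "lax_unit Q"
    "comp_func Q Q"
    "\<lambda>X Y. ar Q (lax_mult Q X Y) \<cdot> lax_mult Q (ob Q X) (ob Q Y)"
    "ar Q (lax_unit Q) \<cdot> lax_unit Q"
    "comult Q" +
  counit_mon: monoidal_nat_trans C C Q "lax_mult Q" "lax_unit Q"
    id_func "\<lambda>X Y. Ident C (X \<otimes>\<^bsub>C\<^esub> Y)" "Ident C (unit C)" "counit Q"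
  for C :: "('o, 'm, 'x) moncat_scheme" (structure) and Q :: "('o, 'm, 'y) hopf_comnd_scheme"

definition is_coalgebra ::
  "('o, 'm, 'x) cat_scheme \<Rightarrow> ('o, 'm, 'y) comnd_scheme \<Rightarrow> 'o \<times> 'm \<Rightarrow> bool" where
  "is_coalgebra C Q = (\<lambda>(V, a). V \<in> Obj C \<and> a \<in> hom C V (ob Q V) \<and>
     counit Q V \<cdot>\<^bsub>C\<^esub> a = Ident C V \<and> comult Q V \<cdot>\<^bsub>C\<^esub> a = ar Q a \<cdot>\<^bsub>C\<^esub> a)"

definition is_coalgebra_map ::
  "('o, 'm, 'x) cat_scheme \<Rightarrow> ('o, 'm, 'y) comnd_scheme \<Rightarrow> 'o \<times> 'm \<Rightarrow> 'm \<Rightarrow> 'o \<times> 'm \<Rightarrow> bool" where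
  "is_coalgebra_map C Q = (\<lambda>(V, a) f (W, b). f \<in> hom C V W \<and> b \<cdot>\<^bsub>C\<^esub> f = ar Q f \<cdot>\<^bsub>C\<^esub> a)"

text \<open>A morphism of coalgebras is stored together with its source and its target, since the
  same underlying arrow may be a morphism between several pairs of coalgebras.\<close>

type_synonym ('o, 'm) coalg_arr = "('o \<times> 'm) \<times> 'm \<times> ('o \<times> 'm)"

definition Cog :: "('o, 'm, 'x) cat_scheme \<Rightarrow> ('o, 'm, 'y) comnd_scheme
    \<Rightarrow> ('o \<times> 'm, ('o, 'm) coalg_arr) cat" where
  "Cog C Q = \<lparr>Obj = {A. is_coalgebra C Q A},
     Arr = {(A, f, B). is_coalgebra C Q A \<and> is_coalgebra C Q B \<and> is_coalgebra_map C Q A f B},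
     Dom = (\<lambda>(A, f, B). A), Cod = (\<lambda>(A, f, B). B),
     Ident = (\<lambda>A. (A, Ident C (fst A), A)),
     Comp = (\<lambda>(B, g, B') (A, f, A'). (A, g \<cdot>\<^bsub>C\<^esub> f, B'))\<rparr>"

definition forget :: "('o \<times> 'm, ('o, 'm) coalg_arr, 'o, 'm) func" where
  "forget = \<lparr>ob = fst, ar = (\<lambda>(A, f, B). f)\<rparr>"

definition coalg_tensor :: "('o, 'm, 'x) moncat_scheme \<Rightarrow> ('o, 'm, 'y) hopf_comnd_scheme
    \<Rightarrow> 'o \<times> 'm \<Rightarrow> 'o \<times> 'm \<Rightarrow> 'o \<times> 'm" where
  "coalg_tensor C Q = (\<lambda>(V, a) (W, b). (V \<otimes>\<^bsub>C\<^esub> W, lax_mult Q V W \<cdot>\<^bsub>C\<^esub> (a \<odot>\<^bsub>C\<^esub> b)))"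

definition Cog_mon :: "('o, 'm, 'x) moncat_scheme \<Rightarrow> ('o, 'm, 'y) hopf_comnd_scheme
    \<Rightarrow> ('o \<times> 'm, ('o, 'm) coalg_arr) moncat" where
  "Cog_mon C Q = (let t = coalg_tensor C Q; i = (unit C, lax_unit Q) in
     cat.extend (Cog C Q) (moncat.fields
       \<lparr>ob = (\<lambda>(A, B). t A B),
        ar = (\<lambda>((A, f, A'), (B, g, B')). (t A B, f \<odot>\<^bsub>C\<^esub> g, t A' B'))\<rparr>
       i
       (\<lambda>A B D. (t (t A B) D, assoc C (fst A) (fst B) (fst D), t A (t B D)))
       (\<lambda>A. (t i A, lunit C (fst A), A))
       (\<lambda>A. (t A i, runit C (fst A), A))))"


section \<open>Tensorisations, enrichments and cotensorisations\<close>

text \<open>The structural maps are \<open>\<one> \<boxtimes> X \<rightarrow> X\<close> and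
  \<open>(V' \<otimes> V) \<boxtimes> X \<rightarrow> V' \<boxtimes> (V \<boxtimes> X)\<close>; they need not be invertible.\<close>

record ('o, 'm, 'p, 'n) tensn = "('o \<times> 'p, 'm \<times> 'n, 'p, 'n) func" +
  act_unit :: "'p \<Rightarrow> 'n"
  act_assoc :: "'o \<Rightarrow> 'o \<Rightarrow> 'p \<Rightarrow> 'n"

locale tensorisation =
  mon: monoidal_category E + cat: category D + act: cat_functor "prod_cat E D" D T
  for E :: "('o, 'm, 'x) moncat_scheme" and D :: "('p, 'n, 'y) cat_scheme" (structure)
    and T :: "('o, 'm, 'p, 'n, 'z) tensn_scheme" +
  assumes act_unit_in: "X \<in> Obj D \<Longrightarrow> act_unit T X \<in> hom D (ob T (unit E, X)) X"
    and act_assoc_in: "\<lbrakk>V' \<in> Obj E; V \<in> Obj E; X \<in> Obj D\<rbrakk>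
      \<Longrightarrow> act_assoc T V' V X \<in> hom D (ob T (V' \<otimes>\<^bsub>E\<^esub> V, X)) (ob T (V', ob T (V, X)))"
    and act_unit_natural: "x \<in> hom D X Y
      \<Longrightarrow> act_unit T Y \<cdot> ar T (Ident E (unit E), x) = x \<cdot> act_unit T X"
    and act_assoc_natural: "\<lbrakk>v' \<in> hom E V' W'; v \<in> hom E V W; x \<in> hom D X Y\<rbrakk>
      \<Longrightarrow> act_assoc T W' W Y \<cdot> ar T (v' \<odot>\<^bsub>E\<^esub> v, x) = ar T (v', ar T (v, x)) \<cdot> act_assoc T V' V X"
    and act_coherence_assoc:
      "\<lbrakk>V'' \<in> Obj E; V' \<in> Obj E; V \<in> Obj E; X \<in> Obj D\<rbrakk>
        \<Longrightarrow> act_assoc T V'' V' (ob T (V, X)) \<cdot> act_assoc T (V'' \<otimes>\<^bsub>E\<^esub> V') V X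
          = ar T (Ident E V'', act_assoc T V' V X) \<cdot> act_assoc T V'' (V' \<otimes>\<^bsub>E\<^esub> V) X
              \<cdot> ar T (assoc E V'' V' V, Ident D X)"
    and act_coherence_lunit:
      "\<lbrakk>V \<in> Obj E; X \<in> Obj D\<rbrakk>
        \<Longrightarrow> act_unit T (ob T (V, X)) \<cdot> act_assoc T (unit E) V X = ar T (lunit E V, Ident D X)"
    and act_coherence_runit:
      "\<lbrakk>V \<in> Obj E; X \<in> Obj D\<rbrakk>
        \<Longrightarrow> ar T (Ident E V, act_unit T X) \<cdot> act_assoc T V (unit E) X = ar T (runit E V, Ident D X)"

text \<open>Below, \<open>ob H (X, Y)\<close> is \<open>{X, Y}\<close> and \<open>ob P (Y, V)\<close> is \<open>\<langle>Y, V\<rangle>\<close>.\<close>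

locale enriched_tensored_cotensored =
  tensorisation E D T +
  enrich: cat_functor "prod_cat (op_cat D) D" E H +
  cotens: cat_functor "prod_cat D (op_cat E)" D P
  for E :: "('o, 'm, 'x) moncat_scheme" and D :: "('p, 'n, 'y) cat_scheme" (structure)
    and T :: "('o, 'm, 'p, 'n, 'z) tensn_scheme"
    and H :: "('p \<times> 'p, 'n \<times> 'n, 'o, 'm, 'u) func_scheme"
    and P :: "('p \<times> 'o, 'n \<times> 'm, 'p, 'n, 'w) func_scheme" +
  fixes \<phi> :: "'o \<Rightarrow> 'p \<Rightarrow> 'p \<Rightarrow> 'n \<Rightarrow> 'm"
    and \<psi> :: "'o \<Rightarrow> 'p \<Rightarrow> 'p \<Rightarrow> 'm \<Rightarrow> 'n"
  assumes enrich_bij: "\<lbrakk>V \<in> Obj E; X \<in> Obj D; Y \<in> Obj D\<rbrakk>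
      \<Longrightarrow> bij_betw (\<phi> V X Y) (hom D (ob T (V, X)) Y) (hom E V (ob H (X, Y)))"
    and cotens_bij: "\<lbrakk>V \<in> Obj E; X \<in> Obj D; Y \<in> Obj D\<rbrakk>
      \<Longrightarrow> bij_betw (\<psi> V X Y) (hom E V (ob H (X, Y))) (hom D X (ob P (Y, V)))"
    and enrich_natural:
      "\<lbrakk>v \<in> hom E V' V; x \<in> hom D X' X; y \<in> hom D Y Y'; f \<in> hom D (ob T (V, X)) Y\<rbrakk>
        \<Longrightarrow> \<phi> V' X' Y' (y \<cdot> f \<cdot> ar T (v, x)) = ar H (x, y) \<cdot>\<^bsub>E\<^esub> \<phi> V X Y f \<cdot>\<^bsub>E\<^esub> v"
    and cotens_natural:
      "\<lbrakk>v \<in> hom E V' V; x \<in> hom D X' X; y \<in> hom D Y Y'; h \<in> hom E V (ob H (X, Y))\<rbrakk>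
        \<Longrightarrow> \<psi> V' X' Y' (ar H (x, y) \<cdot>\<^bsub>E\<^esub> h \<cdot>\<^bsub>E\<^esub> v) = ar P (y, v) \<cdot> \<psi> V X Y h \<cdot> x"

definition lifts_tensorisation ::
  "('o, 'm, 'x) moncat_scheme \<Rightarrow> ('p, 'n, 'y) cat_scheme
    \<Rightarrow> ('o, 'm, 'u) hopf_comnd_scheme \<Rightarrow> ('p, 'n, 'w) comnd_scheme
    \<Rightarrow> ('o, 'm, 'p, 'n, 'z) tensn_scheme
    \<Rightarrow> ('o \<times> 'm, ('o, 'm) coalg_arr, 'p \<times> 'n, ('p, 'n) coalg_arr, 'k) tensn_scheme \<Rightarrow> bool" where
  "lifts_tensorisation C D Q R T T' \<longleftrightarrow>
     (\<forall>A \<in> Obj (Cog C Q). \<forall>X \<in> Obj (Cog D R).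
        ob forget (ob T' (A, X)) = ob T (ob forget A, ob forget X)) \<and>
     (\<forall>f \<in> Arr (Cog C Q). \<forall>x \<in> Arr (Cog D R).
        ar forget (ar T' (f, x)) = ar T (ar forget f, ar forget x)) \<and>
     (\<forall>X \<in> Obj (Cog D R). ar forget (act_unit T' X) = act_unit T (ob forget X)) \<and>
     (\<forall>A' \<in> Obj (Cog C Q). \<forall>A \<in> Obj (Cog C Q). \<forall>X \<in> Obj (Cog D R).
        ar forget (act_assoc T' A' A X)
          = act_assoc T (ob forget A') (ob forget A) (ob forget X))"


section \<open>The coalgebras of a Hopf comonad form a monoidal category\<close>

lemma hom_prod_cat: "(f, g) \<in> hom (prod_cat C D) (X, Y) (X', Y')
  \<longleftrightarrow> f \<in> hom C X X' \<and> g \<in> hom D Y Y'"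
  by (auto simp: hom_def prod_cat_def)

lemma Comp_prod_cat: "(g, g') \<cdot>\<^bsub>prod_cat C D\<^esub> (f, f') = (g \<cdot>\<^bsub>C\<^esub> f, g' \<cdot>\<^bsub>D\<^esub> f')"
  by (simp add: prod_cat_def)

lemma Ident_prod_cat: "Ident (prod_cat C D) (X, Y) = (Ident C X, Ident D Y)"
  by (simp add: prod_cat_def)

lemma category_prod_cat:
  assumes "category C" "category D" shows "category (prod_cat C D)"
proof -
  interpret C: category C by fact
  interpret D: category D by fact
  show ?thesis
  proof
    fix f g h X Y Z W
    show "f \<in> Arr (prod_cat C D) \<Longrightarrow> Dom (prod_cat C D) f \<in> Obj (prod_cat C D)"
      "f \<in> Arr (prod_cat C D) \<Longrightarrow> Cod (prod_cat C D) f \<in> Obj (prod_cat C D)"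
      by (auto simp: prod_cat_def C.Dom_in D.Dom_in C.Cod_in D.Cod_in)
    show "X \<in> Obj (prod_cat C D) \<Longrightarrow> Ident (prod_cat C D) X \<in> hom (prod_cat C D) X X"
      by (cases X) (simp add: hom_prod_cat Ident_prod_cat, simp add: prod_cat_def C.Ident_in D.Ident_in)
    show "\<lbrakk>f \<in> hom (prod_cat C D) X Y; g \<in> hom (prod_cat C D) Y Z\<rbrakk>
        \<Longrightarrow> g \<cdot>\<^bsub>prod_cat C D\<^esub> f \<in> hom (prod_cat C D) X Z"
      by (cases f, cases g, cases X, cases Y, cases Z)
        (auto simp: hom_prod_cat Comp_prod_cat intro: C.Comp_in D.Comp_in)
    show "f \<in> hom (prod_cat C D) X Y \<Longrightarrow> Ident (prod_cat C D) Y \<cdot>\<^bsub>prod_cat C D\<^esub> f = f"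
      "f \<in> hom (prod_cat C D) X Y \<Longrightarrow> f \<cdot>\<^bsub>prod_cat C D\<^esub> Ident (prod_cat C D) X = f"
      by (cases f; cases X; cases Y; auto simp: hom_prod_cat Comp_prod_cat Ident_prod_cat
          intro: C.Ident_left D.Ident_left C.Ident_right D.Ident_right)+
    show "\<lbrakk>f \<in> hom (prod_cat C D) W X; g \<in> hom (prod_cat C D) X Y; h \<in> hom (prod_cat C D) Y Z\<rbrakk>
        \<Longrightarrow> (h \<cdot>\<^bsub>prod_cat C D\<^esub> g) \<cdot>\<^bsub>prod_cat C D\<^esub> f = h \<cdot>\<^bsub>prod_cat C D\<^esub> g \<cdot>\<^bsub>prod_cat C D\<^esub> f"
      by (cases f, cases g, cases h, cases X, cases Y, cases Z, cases W)
        (auto simp: hom_prod_cat Comp_prod_cat intro: C.Comp_assoc D.Comp_assoc)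
  qed
qed

lemma hom_Cog: "F \<in> hom (Cog C Q) A B \<longleftrightarrow>
  (\<exists>f. F = (A, f, B) \<and> is_coalgebra C Q A \<and> is_coalgebra C Q B \<and> is_coalgebra_map C Q A f B)"
  by (auto simp: hom_def Cog_def)

lemma Comp_Cog: "(B, g, B') \<cdot>\<^bsub>Cog C Q\<^esub> (A, f, A') = (A, g \<cdot>\<^bsub>C\<^esub> f, B')"
  by (simp add: Cog_def)

lemma (in comonad) coalg_map_Ident: "is_coalgebra C Q A \<Longrightarrow> is_coalgebra_map C Q A (Ident C (fst A)) A"
  by (cases A) (auto simp: is_coalgebra_def is_coalgebra_map_def ar_Ident
      source.Ident_in source.Ident_right source.Ident_left)

lemma (in comonad) coalg_map_Comp:
  assumes "is_coalgebra C Q A" "is_coalgebra C Q B" "is_coalgebra C Q D"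
    and f: "is_coalgebra_map C Q A f B" and g: "is_coalgebra_map C Q B g D"
  shows "is_coalgebra_map C Q A (g \<cdot> f) D"
proof -
  obtain V a W b X d where [simp]: "A = (V,a)" "B = (W,b)" "D = (X,d)" by (cases A, cases B, cases D)
  have a: "a \<in> hom C V (ob Q V)" and b: "b \<in> hom C W (ob Q W)" and d: "d \<in> hom C X (ob Q X)"
    using assms by (auto simp: is_coalgebra_def)
  have f: "f \<in> hom C V W" "b \<cdot> f = ar Q f \<cdot> a" and g: "g \<in> hom C W X" "d \<cdot> g = ar Q g \<cdot> b"
    using f g by (auto simp: is_coalgebra_map_def)
  have "d \<cdot> g \<cdot> f = (d \<cdot> g) \<cdot> f" using source.Comp_assoc[OF f(1) g(1) d] by simp
  also have "\<dots> = ar Q g \<cdot> b \<cdot> f" using source.Comp_assoc[OF f(1) b ar_in[OF g(1)]] g by simp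
  also have "\<dots> = (ar Q g \<cdot> ar Q f) \<cdot> a"
    using source.Comp_assoc[OF a ar_in[OF f(1)] ar_in[OF g(1)]] f by simp
  finally have "d \<cdot> g \<cdot> f = ar Q (g \<cdot> f) \<cdot> a" by (simp add: ar_Comp[OF f(1) g(1)])
  then show ?thesis using source.Comp_in[OF f(1) g(1)] by (simp add: is_coalgebra_map_def)
qed

lemma (in comonad) category_Cog: "category (Cog C Q)"
proof unfold_locales
  have map_hom: "is_coalgebra_map C Q A f B \<Longrightarrow> f \<in> hom C (fst A) (fst B)" for A f B
    by (cases A; cases B) (auto simp: is_coalgebra_map_def)
  fix f g h A B D E
  show "f \<in> Arr (Cog C Q) \<Longrightarrow> Dom (Cog C Q) f \<in> Obj (Cog C Q)" by (auto simp: Cog_def)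
  show "f \<in> Arr (Cog C Q) \<Longrightarrow> Cod (Cog C Q) f \<in> Obj (Cog C Q)" by (auto simp: Cog_def)
  show "A \<in> Obj (Cog C Q) \<Longrightarrow> Ident (Cog C Q) A \<in> hom (Cog C Q) A A"
    by (auto simp: hom_Cog coalg_map_Ident) (auto simp: Cog_def coalg_map_Ident)
  show "\<lbrakk>f \<in> hom (Cog C Q) A B; g \<in> hom (Cog C Q) B D\<rbrakk> \<Longrightarrow> g \<cdot>\<^bsub>Cog C Q\<^esub> f \<in> hom (Cog C Q) A D"
    by (auto simp: hom_Cog Comp_Cog intro: coalg_map_Comp)
  show "f \<in> hom (Cog C Q) A B \<Longrightarrow> Ident (Cog C Q) B \<cdot>\<^bsub>Cog C Q\<^esub> f = f"
    by (auto simp: hom_Cog) (auto simp: Cog_def dest: map_hom source.Ident_left)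
  show "f \<in> hom (Cog C Q) A B \<Longrightarrow> f \<cdot>\<^bsub>Cog C Q\<^esub> Ident (Cog C Q) A = f"
    by (auto simp: hom_Cog) (auto simp: Cog_def dest: map_hom source.Ident_right)
  show "\<lbrakk>f \<in> hom (Cog C Q) A B; g \<in> hom (Cog C Q) B D; h \<in> hom (Cog C Q) D E\<rbrakk>
     \<Longrightarrow> (h \<cdot>\<^bsub>Cog C Q\<^esub> g) \<cdot>\<^bsub>Cog C Q\<^esub> f = h \<cdot>\<^bsub>Cog C Q\<^esub> (g \<cdot>\<^bsub>Cog C Q\<^esub> f)"
    by (auto simp: hom_Cog Comp_Cog dest!: map_hom intro: source.Comp_assoc)
qed

context monoidal_category begin

lemma tensor_ob_in: "X \<in> Obj C \<Longrightarrow> Y \<in> Obj C \<Longrightarrow> X \<otimes>\<^bsub>C\<^esub> Y \<in> Obj C"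
  using tensor.ob_in[of "(X, Y)"] by (simp add: prod_cat_def)

lemma tensor_ar_in: "f \<in> hom C X X' \<Longrightarrow> g \<in> hom C Y Y'
  \<Longrightarrow> f \<odot>\<^bsub>C\<^esub> g \<in> hom C (X \<otimes>\<^bsub>C\<^esub> Y) (X' \<otimes>\<^bsub>C\<^esub> Y')"
  using tensor.ar_in[of "(f, g)" "(X, Y)" "(X', Y')"] by (simp add: hom_prod_cat)

lemma tensor_Ident: "X \<in> Obj C \<Longrightarrow> Y \<in> Obj C \<Longrightarrow> Ident C X \<odot>\<^bsub>C\<^esub> Ident C Y = Ident C (X \<otimes>\<^bsub>C\<^esub> Y)"
  using tensor.ar_Ident[of "(X, Y)"] by (simp add: prod_cat_def)

lemma tensor_Comp: "\<lbrakk>f \<in> hom C X Y; g \<in> hom C Y Z; f' \<in> hom C X' Y'; g' \<in> hom C Y' Z'\<rbrakk>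
  \<Longrightarrow> (g \<odot>\<^bsub>C\<^esub> g') \<cdot> (f \<odot>\<^bsub>C\<^esub> f') = (g \<cdot> f) \<odot>\<^bsub>C\<^esub> (g' \<cdot> f')"
  using tensor.ar_Comp[of "(f, f')" "(X, X')" "(Y, Y')" "(g, g')" "(Z, Z')"]
  by (simp add: hom_prod_cat Comp_prod_cat)

end

lemma Cog_mon_sel:
  "Obj (Cog_mon C Q) = Obj (Cog C Q)" "Arr (Cog_mon C Q) = Arr (Cog C Q)"
  "Dom (Cog_mon C Q) = Dom (Cog C Q)" "Cod (Cog_mon C Q) = Cod (Cog C Q)"
  "Ident (Cog_mon C Q) = Ident (Cog C Q)" "Comp (Cog_mon C Q) = Comp (Cog C Q)"
  "unit (Cog_mon C Q) = (unit C, lax_unit Q)"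
  "ob (tensor (Cog_mon C Q)) (A, B) = coalg_tensor C Q A B"
  "ar (tensor (Cog_mon C Q)) ((A,f,A'), (B,g,B'))
    = (coalg_tensor C Q A B, f \<odot>\<^bsub>C\<^esub> g, coalg_tensor C Q A' B')"
  "assoc (Cog_mon C Q) A B D
    = (coalg_tensor C Q (coalg_tensor C Q A B) D, assoc C (fst A) (fst B) (fst D),
       coalg_tensor C Q A (coalg_tensor C Q B D))"
  "lunit (Cog_mon C Q) A
    = (coalg_tensor C Q (unit C, lax_unit Q) A, lunit C (fst A), A)"
  "runit (Cog_mon C Q) A
    = (coalg_tensor C Q A (unit C, lax_unit Q), runit C (fst A), A)"
  by (simp_all add: Cog_mon_def Let_def cat.defs moncat.defs)

lemma hom_Cog_mon: "hom (Cog_mon C Q) = hom (Cog C Q)"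
  by (intro ext) (simp add: hom_def Cog_mon_sel)

lemma fst_coalg_tensor [simp]: "fst (coalg_tensor C Q A B) = fst A \<otimes>\<^bsub>C\<^esub> fst B"
  by (cases A; cases B) (simp add: coalg_tensor_def)

context hopf_comonad begin

lemma coalg_tensor_coalg:
  assumes "is_coalgebra C Q A" "is_coalgebra C Q B"
  shows "is_coalgebra C Q (coalg_tensor C Q A B)"
proof -
  obtain V a W b where [simp]: "A = (V,a)" "B = (W,b)" by (cases A, cases B)
  let ?m = "lax_mult Q"
  have V: "V \<in> Obj C" "W \<in> Obj C"
    and a: "a \<in> hom C V (ob Q V)" "counit Q V \<cdot> a = Ident C V" "comult Q V \<cdot> a = ar Q a \<cdot> a"
    and b: "b \<in> hom C W (ob Q W)" "counit Q W \<cdot> b = Ident C W" "comult Q W \<cdot> b = ar Q b \<cdot> b"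
    using assms by (auto simp: is_coalgebra_def)
  note Q = ob_in[OF V(1)] ob_in[OF V(2)]
  note n = counit.component_in[OF V(1)] counit.component_in[OF V(2)]
  note w = comult.component_in[OF V(1)] comult.component_in[OF V(2)]
  have ab: "a \<odot>\<^bsub>C\<^esub> b \<in> hom C (V \<otimes>\<^bsub>C\<^esub> W) (ob Q V \<otimes>\<^bsub>C\<^esub> ob Q W)" using a b source_mon.tensor_ar_in by blast
  have m: "?m V W \<in> hom C (ob Q V \<otimes>\<^bsub>C\<^esub> ob Q W) (ob Q (V \<otimes>\<^bsub>C\<^esub> W))" using V mult_in by blast
  have m2: "?m (ob Q V) (ob Q W) 
      \<in> hom C (ob Q (ob Q V) \<otimes>\<^bsub>C\<^esub> ob Q (ob Q W)) (ob Q (ob Q V \<otimes>\<^bsub>C\<^esub> ob Q W))"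
    using Q mult_in by blast
  have VW: "V \<otimes>\<^bsub>C\<^esub> W \<in> Obj C" using V source_mon.tensor_ob_in by blast
  note nVW = counit.component_in[OF VW] note wVW = comult.component_in[OF VW]
  note unf = id_func_def comp_func_def
  have "counit Q (V \<otimes>\<^bsub>C\<^esub> W) \<cdot> ?m V W \<cdot> (a \<odot>\<^bsub>C\<^esub> b) = (counit Q (V \<otimes>\<^bsub>C\<^esub> W) \<cdot> ?m V W) \<cdot> (a \<odot>\<^bsub>C\<^esub> b)"
    using source.Comp_assoc[OF ab m nVW[unfolded unf]] by simp
  also have "\<dots> = (counit Q V \<odot>\<^bsub>C\<^esub> counit Q W) \<cdot> (a \<odot>\<^bsub>C\<^esub> b)"
    using counit_mon.monoidal_mult[OF V] source_mon.tensor_ar_in[OF n, THEN source.Ident_left] by (simp add: unf)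
  also have "\<dots> = Ident C (V \<otimes>\<^bsub>C\<^esub> W)"
    using source_mon.tensor_Comp[OF a(1) n(1) b(1) n(2)] a b source_mon.tensor_Ident[OF V] by simp
  finally have 1: "counit Q (V \<otimes>\<^bsub>C\<^esub> W) \<cdot> ?m V W \<cdot> (a \<odot>\<^bsub>C\<^esub> b) = Ident C (V \<otimes>\<^bsub>C\<^esub> W)" .
  note Qa = ar_in[OF a(1)] ar_in[OF b(1)]
  note Qab = source_mon.tensor_ar_in[OF Qa]
  have "comult Q (V \<otimes>\<^bsub>C\<^esub> W) \<cdot> ?m V W \<cdot> (a \<odot>\<^bsub>C\<^esub> b) = (comult Q (V \<otimes>\<^bsub>C\<^esub> W) \<cdot> ?m V W) \<cdot> (a \<odot>\<^bsub>C\<^esub> b)"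
    using source.Comp_assoc[OF ab m wVW[unfolded unf]] by simp
  also have "\<dots> = ((ar Q (?m V W) \<cdot> ?m (ob Q V) (ob Q W)) \<cdot> (comult Q V \<odot>\<^bsub>C\<^esub> comult Q W)) \<cdot> (a \<odot>\<^bsub>C\<^esub> b)"
    using comult_mon.monoidal_mult[OF V] by (simp add: unf)
  also have "\<dots> = (ar Q (?m V W) \<cdot> ?m (ob Q V) (ob Q W)) \<cdot> ((comult Q V \<odot>\<^bsub>C\<^esub> comult Q W) \<cdot> (a \<odot>\<^bsub>C\<^esub> b))"
    using source.Comp_assoc[OF ab source_mon.tensor_ar_in[OF w] source.Comp_in] m2 ar_in[OF m] by (simp add: unf)
  also have "\<dots> = (ar Q (?m V W) \<cdot> ?m (ob Q V) (ob Q W)) \<cdot> ((ar Q a \<odot>\<^bsub>C\<^esub> ar Q b) \<cdot> (a \<odot>\<^bsub>C\<^esub> b))"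
    using source_mon.tensor_Comp[OF a(1) w(1) b(1) w(2)]
      source_mon.tensor_Comp[OF a(1) Qa(1) b(1) Qa(2)] a b by simp
  also have "\<dots> = ar Q (?m V W) \<cdot> (?m (ob Q V) (ob Q W) \<cdot> (ar Q a \<odot>\<^bsub>C\<^esub> ar Q b)) \<cdot> (a \<odot>\<^bsub>C\<^esub> b)"
    using source.Comp_assoc[OF source.Comp_in[OF ab Qab] m2 ar_in[OF m]]
      source.Comp_assoc[OF ab Qab m2] by simp
  also have "\<dots> = ar Q (?m V W) \<cdot> (ar Q (a \<odot>\<^bsub>C\<^esub> b) \<cdot> ?m V W) \<cdot> (a \<odot>\<^bsub>C\<^esub> b)"
    using mult_natural[OF a(1) b(1)] by simp
  also have "\<dots> = (ar Q (?m V W) \<cdot> ar Q (a \<odot>\<^bsub>C\<^esub> b)) \<cdot> ?m V W \<cdot> (a \<odot>\<^bsub>C\<^esub> b)"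
    using source.Comp_assoc[OF ab m ar_in[OF ab]]
      source.Comp_assoc[OF source.Comp_in[OF ab m] ar_in[OF ab] ar_in[OF m]] by simp
  also have "\<dots> = ar Q (?m V W \<cdot> (a \<odot>\<^bsub>C\<^esub> b)) \<cdot> ?m V W \<cdot> (a \<odot>\<^bsub>C\<^esub> b)"
    using ar_Comp[OF ab m] by simp
  finally show ?thesis using 1 source.Comp_in[OF ab m] VW by (simp add: coalg_tensor_def is_coalgebra_def)
qed

lemma coalg_map_tensor:
  assumes A: "is_coalgebra C Q A" "is_coalgebra C Q A'" "is_coalgebra C Q B" "is_coalgebra C Q B'"
    and fg: "is_coalgebra_map C Q A f A'" "is_coalgebra_map C Q B g B'"
  shows "is_coalgebra_map C Q (coalg_tensor C Q A B) (f \<odot>\<^bsub>C\<^esub> g) (coalg_tensor C Q A' B')"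
proof -
  obtain V a W b V' a' W' b' where [simp]: "A = (V,a)" "B = (W,b)" "A' = (V',a')" "B' = (W',b')"
    by (cases A, cases B, cases A', cases B')
  have V: "V \<in> Obj C" "W \<in> Obj C" "V' \<in> Obj C" "W' \<in> Obj C"
    and a: "a \<in> hom C V (ob Q V)" "b \<in> hom C W (ob Q W)"
      "a' \<in> hom C V' (ob Q V')" "b' \<in> hom C W' (ob Q W')"
    using A by (auto simp: is_coalgebra_def)
  have f: "f \<in> hom C V V'" "a' \<cdot> f = ar Q f \<cdot> a" and g: "g \<in> hom C W W'" "b' \<cdot> g = ar Q g \<cdot> b"
    using fg by (auto simp: is_coalgebra_map_def)
  let ?m = "lax_mult Q"
  note t = source_mon.tensor_ar_in
  have "(?m V' W' \<cdot> (a' \<odot>\<^bsub>C\<^esub> b')) \<cdot> (f \<odot>\<^bsub>C\<^esub> g) = ?m V' W' \<cdot> ((a' \<odot>\<^bsub>C\<^esub> b') \<cdot> (f \<odot>\<^bsub>C\<^esub> g))"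
    by (rule source.Comp_assoc[OF t[OF f(1) g(1)] t[OF a(3,4)] mult_in[OF V(3,4)]])
  also have "(a' \<odot>\<^bsub>C\<^esub> b') \<cdot> (f \<odot>\<^bsub>C\<^esub> g) = (ar Q f \<odot>\<^bsub>C\<^esub> ar Q g) \<cdot> (a \<odot>\<^bsub>C\<^esub> b)"
    using source_mon.tensor_Comp[OF f(1) a(3) g(1) a(4)]
      source_mon.tensor_Comp[OF a(1) ar_in[OF f(1)] a(2) ar_in[OF g(1)]] f g by simp
  also have "?m V' W' \<cdot> \<dots> = (?m V' W' \<cdot> (ar Q f \<odot>\<^bsub>C\<^esub> ar Q g)) \<cdot> (a \<odot>\<^bsub>C\<^esub> b)"
    by (rule source.Comp_assoc[OF t[OF a(1,2)] t[OF ar_in ar_in, OF f(1) g(1)] mult_in[OF V(3,4)], symmetric])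
  also have "\<dots> = (ar Q (f \<odot>\<^bsub>C\<^esub> g) \<cdot> ?m V W) \<cdot> (a \<odot>\<^bsub>C\<^esub> b)" by (simp add: mult_natural[OF f(1) g(1)])
  also have "\<dots> = ar Q (f \<odot>\<^bsub>C\<^esub> g) \<cdot> ?m V W \<cdot> (a \<odot>\<^bsub>C\<^esub> b)"
    by (rule source.Comp_assoc[OF t[OF a(1,2)] mult_in[OF V(1,2)] ar_in[OF t[OF f(1) g(1)]]])
  finally show ?thesis using t[OF f(1) g(1)] by (simp add: is_coalgebra_map_def coalg_tensor_def)
qed

lemma unit_coalg: "is_coalgebra C Q (unit C, lax_unit Q)"
  using source_mon.unit_in unit_map_in counit_mon.monoidal_unit comult_mon.monoidal_unit
  by (simp add: is_coalgebra_def)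

lemma assoc_map:
  assumes A: "is_coalgebra C Q A" "is_coalgebra C Q B" "is_coalgebra C Q D"
  shows "is_coalgebra_map C Q (coalg_tensor C Q (coalg_tensor C Q A B) D)
    (assoc C (fst A) (fst B) (fst D)) (coalg_tensor C Q A (coalg_tensor C Q B D))"
proof -
  obtain V a W b X d where [simp]: "A = (V,a)" "B = (W,b)" "D = (X,d)" by (cases A, cases B, cases D)
  have V: "V \<in> Obj C" "W \<in> Obj C" "X \<in> Obj C"
    and a: "a \<in> hom C V (ob Q V)" "b \<in> hom C W (ob Q W)" "d \<in> hom C X (ob Q X)"
    using A by (auto simp: is_coalgebra_def)
  let ?m = "lax_mult Q"
  note t = source_mon.tensor_ar_in and to = source_mon.tensor_ob_in
  note Q = ob_in[OF V(1)] ob_in[OF V(2)] ob_in[OF V(3)]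
  note I = source.Ident_in[OF Q(1)] source.Ident_in[OF Q(3)]
  note al = source_mon.assoc_in[OF V] and alQ = source_mon.assoc_in[OF Q]
  note m1 = mult_in[OF V(1) to[OF V(2,3)]]
  note m2 = mult_in[OF to[OF V(1,2)] V(3)]
  note mVW = mult_in[OF V(1,2)] and mWX = mult_in[OF V(2,3)]
  have 1: "a \<odot>\<^bsub>C\<^esub> (?m W X \<cdot> (b \<odot>\<^bsub>C\<^esub> d)) = (Ident C (ob Q V) \<odot>\<^bsub>C\<^esub> ?m W X) \<cdot> (a \<odot>\<^bsub>C\<^esub> (b \<odot>\<^bsub>C\<^esub> d))"
    using source_mon.tensor_Comp[OF a(1) I(1) t[OF a(2,3)] mWX] source.Ident_left[OF a(1)] by simp
  have 2: "(?m V W \<cdot> (a \<odot>\<^bsub>C\<^esub> b)) \<odot>\<^bsub>C\<^esub> d = (?m V W \<odot>\<^bsub>C\<^esub> Ident C (ob Q X)) \<cdot> ((a \<odot>\<^bsub>C\<^esub> b) \<odot>\<^bsub>C\<^esub> d)"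
    using source_mon.tensor_Comp[OF t[OF a(1,2)] mVW a(3) I(2)] source.Ident_left[OF a(3)] by simp
  note T1 = t[OF a(1) t[OF a(2,3)]] and T2 = t[OF t[OF a(1,2)] a(3)]
    and T3 = t[OF I(1) mWX] and T4 = t[OF mVW I(2)]
  have "(?m V (W \<otimes>\<^bsub>C\<^esub> X) \<cdot> (Ident C (ob Q V) \<odot>\<^bsub>C\<^esub> ?m W X) \<cdot> (a \<odot>\<^bsub>C\<^esub> (b \<odot>\<^bsub>C\<^esub> d))) \<cdot> assoc C V W X
     = ?m V (W \<otimes>\<^bsub>C\<^esub> X) \<cdot> (Ident C (ob Q V) \<odot>\<^bsub>C\<^esub> ?m W X) \<cdot> ((a \<odot>\<^bsub>C\<^esub> (b \<odot>\<^bsub>C\<^esub> d)) \<cdot> assoc C V W X)"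
    using source.Comp_assoc[OF al source.Comp_in[OF T1 T3] m1] source.Comp_assoc[OF al T1 T3] by simp
  also have "(a \<odot>\<^bsub>C\<^esub> (b \<odot>\<^bsub>C\<^esub> d)) \<cdot> assoc C V W X = assoc C (ob Q V) (ob Q W) (ob Q X) \<cdot> ((a \<odot>\<^bsub>C\<^esub> b) \<odot>\<^bsub>C\<^esub> d)"
    using source_mon.assoc_natural[OF a] by simp
  also have "?m V (W \<otimes>\<^bsub>C\<^esub> X) \<cdot> (Ident C (ob Q V) \<odot>\<^bsub>C\<^esub> ?m W X) \<cdot> \<dots> =
     (?m V (W \<otimes>\<^bsub>C\<^esub> X) \<cdot> (Ident C (ob Q V) \<odot>\<^bsub>C\<^esub> ?m W X) \<cdot> assoc C (ob Q V) (ob Q W) (ob Q X)) \<cdot> ((a \<odot>\<^bsub>C\<^esub> b) \<odot>\<^bsub>C\<^esub> d)"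
    using source.Comp_assoc[OF T2 source.Comp_in[OF alQ T3] m1] source.Comp_assoc[OF T2 alQ T3] by simp
  also have "?m V (W \<otimes>\<^bsub>C\<^esub> X) \<cdot> (Ident C (ob Q V) \<odot>\<^bsub>C\<^esub> ?m W X) \<cdot> assoc C (ob Q V) (ob Q W) (ob Q X) =
     ar Q (assoc C V W X) \<cdot> ?m (V \<otimes>\<^bsub>C\<^esub> W) X \<cdot> (?m V W \<odot>\<^bsub>C\<^esub> Ident C (ob Q X))"
    by (rule mult_assoc[OF V, symmetric])
  also have "\<dots> \<cdot> ((a \<odot>\<^bsub>C\<^esub> b) \<odot>\<^bsub>C\<^esub> d) =
     ar Q (assoc C V W X) \<cdot> ?m (V \<otimes>\<^bsub>C\<^esub> W) X \<cdot> (?m V W \<odot>\<^bsub>C\<^esub> Ident C (ob Q X)) \<cdot> ((a \<odot>\<^bsub>C\<^esub> b) \<odot>\<^bsub>C\<^esub> d)"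
    using source.Comp_assoc[OF T2 source.Comp_in[OF T4 m2] ar_in[OF al]]
      source.Comp_assoc[OF T2 T4 m2] by simp
  finally show ?thesis using al 1 2 by (simp add: is_coalgebra_map_def coalg_tensor_def)
qed

lemma lunit_map:
  assumes A: "is_coalgebra C Q A"
  shows "is_coalgebra_map C Q (coalg_tensor C Q (unit C, lax_unit Q) A) (lunit C (fst A)) A"
proof -
  obtain V a where [simp]: "A = (V,a)" by (cases A)
  have V: "V \<in> Obj C" and a: "a \<in> hom C V (ob Q V)" using A by (auto simp: is_coalgebra_def)
  note t = source_mon.tensor_ar_in
  note U = source_mon.unit_in note I = source.Ident_in[OF U] note QV = ob_in[OF V]
  have "a \<cdot> lunit C V = lunit C (ob Q V) \<cdot> (Ident C (unit C) \<odot>\<^bsub>C\<^esub> a)"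
    using source_mon.lunit_natural[OF a] by simp
  also have "\<dots> = (ar Q (lunit C V) \<cdot> lax_mult Q (unit C) V \<cdot> (lax_unit Q \<odot>\<^bsub>C\<^esub> Ident C (ob Q V))) \<cdot> (Ident C (unit C) \<odot>\<^bsub>C\<^esub> a)"
    by (simp add: mult_lunit[OF V])
  also have "\<dots> = ar Q (lunit C V) \<cdot> lax_mult Q (unit C) V \<cdot> (lax_unit Q \<odot>\<^bsub>C\<^esub> Ident C (ob Q V)) \<cdot> (Ident C (unit C) \<odot>\<^bsub>C\<^esub> a)"
    using source.Comp_assoc[OF t[OF I a] source.Comp_in[OF t[OF unit_map_in source.Ident_in[OF QV]] mult_in[OF U V]]
      ar_in[OF source_mon.lunit_in[OF V]]]
     source.Comp_assoc[OF t[OF I a] t[OF unit_map_in source.Ident_in[OF QV]] mult_in[OF U V]] by simp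
  also have "(lax_unit Q \<odot>\<^bsub>C\<^esub> Ident C (ob Q V)) \<cdot> (Ident C (unit C) \<odot>\<^bsub>C\<^esub> a) = lax_unit Q \<odot>\<^bsub>C\<^esub> a"
    using source_mon.tensor_Comp[OF I unit_map_in a source.Ident_in[OF QV]]
      source.Ident_left[OF a] source.Ident_right[OF unit_map_in] by simp
  finally show ?thesis using source_mon.lunit_in[OF V] by (simp add: is_coalgebra_map_def coalg_tensor_def)
qed

lemma runit_map:
  assumes A: "is_coalgebra C Q A"
  shows "is_coalgebra_map C Q (coalg_tensor C Q A (unit C, lax_unit Q)) (runit C (fst A)) A"
proof -
  obtain V a where [simp]: "A = (V,a)" by (cases A)
  have V: "V \<in> Obj C" and a: "a \<in> hom C V (ob Q V)" using A by (auto simp: is_coalgebra_def)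
  note t = source_mon.tensor_ar_in
  note U = source_mon.unit_in note I = source.Ident_in[OF U] note QV = ob_in[OF V]
  have "a \<cdot> runit C V = runit C (ob Q V) \<cdot> (a \<odot>\<^bsub>C\<^esub> Ident C (unit C))"
    using source_mon.runit_natural[OF a] by simp
  also have "\<dots> = (ar Q (runit C V) \<cdot> lax_mult Q V (unit C) \<cdot> (Ident C (ob Q V) \<odot>\<^bsub>C\<^esub> lax_unit Q)) \<cdot> (a \<odot>\<^bsub>C\<^esub> Ident C (unit C))"
    by (simp add: mult_runit[OF V])
  also have "\<dots> = ar Q (runit C V) \<cdot> lax_mult Q V (unit C) \<cdot> (Ident C (ob Q V) \<odot>\<^bsub>C\<^esub> lax_unit Q) \<cdot> (a \<odot>\<^bsub>C\<^esub> Ident C (unit C))"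
    using source.Comp_assoc[OF t[OF a I] source.Comp_in[OF t[OF source.Ident_in[OF QV] unit_map_in] mult_in[OF V U]]
      ar_in[OF source_mon.runit_in[OF V]]]
     source.Comp_assoc[OF t[OF a I] t[OF source.Ident_in[OF QV] unit_map_in] mult_in[OF V U]] by simp
  also have "(Ident C (ob Q V) \<odot>\<^bsub>C\<^esub> lax_unit Q) \<cdot> (a \<odot>\<^bsub>C\<^esub> Ident C (unit C)) = a \<odot>\<^bsub>C\<^esub> lax_unit Q"
    using source_mon.tensor_Comp[OF a source.Ident_in[OF QV] I unit_map_in]
      source.Ident_left[OF a] source.Ident_right[OF unit_map_in] by simp
  finally show ?thesis using source_mon.runit_in[OF V] by (simp add: is_coalgebra_map_def coalg_tensor_def)
qed

lemma inverse_map: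
  assumes A: "is_coalgebra C Q A" "is_coalgebra C Q B" "is_coalgebra_map C Q A f B"
    and g: "g \<in> hom C (fst B) (fst A)" "g \<cdot> f = Ident C (fst A)" "f \<cdot> g = Ident C (fst B)"
  shows "is_coalgebra_map C Q B g A"
proof -
  obtain V a W b where [simp]: "A = (V,a)" "B = (W,b)" by (cases A, cases B)
  have V: "V \<in> Obj C" "W \<in> Obj C" and a: "a \<in> hom C V (ob Q V)" "b \<in> hom C W (ob Q W)"
    and f: "f \<in> hom C V W" "b \<cdot> f = ar Q f \<cdot> a" using A by (auto simp: is_coalgebra_def is_coalgebra_map_def)
  have g: "g \<in> hom C W V" "g \<cdot> f = Ident C V" "f \<cdot> g = Ident C W" using g by auto
  have "a \<cdot> g = (ar Q g \<cdot> ar Q f) \<cdot> a \<cdot> g"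
    using source.Ident_left[OF source.Comp_in[OF g(1) a(1)]] ar_Comp[OF f(1) g(1)] g(2)
      ar_Ident[OF V(1)] by simp
  also have "\<dots> = ar Q g \<cdot> (ar Q f \<cdot> a) \<cdot> g"
    using source.Comp_assoc[OF source.Comp_in[OF g(1) a(1)] ar_in[OF f(1)] ar_in[OF g(1)]]
      source.Comp_assoc[OF g(1) a(1) ar_in[OF f(1)]] by simp
  also have "\<dots> = ar Q g \<cdot> (b \<cdot> f) \<cdot> g" using f by simp
  also have "\<dots> = ar Q g \<cdot> b" using source.Comp_assoc[OF g(1) f(1) a(2)] g(3) source.Ident_right[OF a(2)] by simp
  finally show ?thesis using g by (simp add: is_coalgebra_map_def)
qed

lemma is_iso_Cog:
  assumes "is_coalgebra C Q A" "is_coalgebra C Q B" "is_coalgebra_map C Q A f B" "is_iso C f"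
  shows "is_iso (Cog_mon C Q) (A, f, B)"
proof -
  have f: "f \<in> hom C (fst A) (fst B)" using assms(3) by (cases A; cases B) (auto simp: is_coalgebra_map_def)
  then obtain g where g: "g \<in> hom C (fst B) (fst A)" "g \<cdot> f = Ident C (fst A)" "f \<cdot> g = Ident C (fst B)"
    using assms(4) unfolding is_iso_def hom_def by auto
  have "(B, g, A) \<in> hom (Cog C Q) B A" "(A, f, B) \<in> Arr (Cog C Q)"
    using inverse_map[OF assms(1-3) g] assms by (simp add: hom_Cog, simp add: Cog_def)
  moreover have "Dom (Cog C Q) (A, f, B) = A" "Cod (Cog C Q) (A, f, B) = B" by (simp_all add: Cog_def)
  moreover have "Ident (Cog C Q) D = (D, Ident C (fst D), D)" for D by (simp add: Cog_def)
  ultimately show ?thesis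
    using g by (auto simp: is_iso_def Cog_mon_sel hom_Cog_mon Comp_Cog intro!: bexI[of _ "(B, g, A)"])
qed

lemma Obj_Cog: "A \<in> Obj (Cog C Q) \<longleftrightarrow> is_coalgebra C Q A" by (simp add: Cog_def)
lemma Ident_Cog: "Ident (Cog C Q) A = (A, Ident C (fst A), A)" by (simp add: Cog_def)

lemma map_hom: "is_coalgebra_map C Q A f B \<Longrightarrow> f \<in> hom C (fst A) (fst B)"
    by (cases A; cases B) (auto simp: is_coalgebra_map_def)
lemma coalg_Obj: "is_coalgebra C Q A \<Longrightarrow> fst A \<in> Obj C" by (cases A) (auto simp: is_coalgebra_def)

lemma monoidal_category_Cog_mon: "monoidal_category (Cog_mon C Q)"
proof -
  have cat: "category (Cog_mon C Q)"
    using category_Cog by (simp add: category_def Cog_mon_sel hom_Cog_mon)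
  let ?M = "Cog_mon C Q" and ?MM = "prod_cat (Cog_mon C Q) (Cog_mon C Q)"
  have ten: "cat_functor ?MM ?M (tensor ?M)"
  proof (intro cat_functor.intro cat_functor_axioms.intro category_prod_cat cat)
    fix A f g B D
    show "A \<in> Obj ?MM \<Longrightarrow> ob (tensor ?M) A \<in> Obj ?M"
      by (cases A) (auto simp: prod_cat_def Cog_mon_sel Obj_Cog coalg_tensor_coalg)
    show "f \<in> hom ?MM A B \<Longrightarrow>
       ar (tensor ?M) f \<in> hom ?M (ob (tensor ?M) A) (ob (tensor ?M) B)"
      by (cases f; cases A; cases B)
        (auto simp: hom_prod_cat hom_Cog_mon hom_Cog Cog_mon_sel coalg_tensor_coalg coalg_map_tensor)
    show "A \<in> Obj ?MM \<Longrightarrow>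
       ar (tensor ?M) (Ident ?MM A) = Ident ?M (ob (tensor ?M) A)"
      by (cases A) (auto simp: Ident_prod_cat Cog_mon_sel Ident_Cog,
          auto simp: prod_cat_def Cog_mon_sel Obj_Cog source_mon.tensor_Ident dest!: coalg_Obj)
    show "\<lbrakk>f \<in> hom ?MM A B; g \<in> hom ?MM B D\<rbrakk>
      \<Longrightarrow>
       ar (tensor ?M) (g \<cdot>\<^bsub>?MM\<^esub> f) =
       ar (tensor ?M) g \<cdot>\<^bsub>?M\<^esub> ar (tensor ?M) f"
      by (cases f; cases g; cases A; cases B; cases D)
        (auto simp: hom_prod_cat Comp_prod_cat hom_Cog_mon hom_Cog Cog_mon_sel Comp_Cog
          dest!: map_hom intro: source_mon.tensor_Comp[symmetric])
  qed
  have str: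
    "is_coalgebra_map C Q (coalg_tensor C Q (coalg_tensor C Q (V,a) (W,b)) (X,d))
       (assoc C V W X) (coalg_tensor C Q (V,a) (coalg_tensor C Q (W,b) (X,d)))"
    "is_coalgebra_map C Q (coalg_tensor C Q (unit C, lax_unit Q) (V,a)) (lunit C V) (V,a)"
    "is_coalgebra_map C Q (coalg_tensor C Q (V,a) (unit C, lax_unit Q)) (runit C V) (V,a)"
    if "is_coalgebra C Q (V,a)" "is_coalgebra C Q (W,b)" "is_coalgebra C Q (X,d)" for V a W b X d
    using assoc_map[OF that] lunit_map[OF that(1)] runit_map[OF that(1)] by simp_all
  show ?thesis
    by (intro monoidal_category.intro monoidal_category_axioms.intro cat ten)
      (auto simp: Cog_mon_sel hom_Cog_mon hom_Cog Comp_Cog Obj_Cog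
          Ident_Cog unit_coalg coalg_tensor_coalg str
        intro!: is_iso_Cog source_mon.assoc_iso source_mon.lunit_iso source_mon.runit_iso coalg_Obj
           source_mon.assoc_natural source_mon.lunit_natural source_mon.runit_natural source_mon.pentagon
           source_mon.triangle dest!: map_hom)
qed

end

end

theory Submission
  imports Defs
begin

text \<open>A category tensored over \<open>E\<close> is enriched and cotensored over \<open>E\<close> as soon as each
  functor \<open>- \<boxtimes> X : E \<rightarrow> D\<close> and each functor \<open>V \<boxtimes> - : D \<rightarrow> D\<close> has a right adjoint: right
  adjoints chosen pointwise assemble into bifunctors \<open>{-,-}\<close> and \<open>\<langle>-,-\<rangle>\<close> (adjunctions with a
  parameter, \<open>parametrised_right_adjoint\<close>). For coalgebras the two families of functors are lifts,
  along the forgetful functors, of functors on the base categories which do have right adjoints.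
  So everything reduces to a lifting theorem for adjoints.

  Let \<open>F : K \<rightarrow> Cog D R\<close> be a functor whose underlying functor \<open>L : K \<rightarrow> D\<close> has a right adjoint
  \<open>G\<close>. Every coalgebra \<open>B = (Y, b)\<close> is the equaliser of the pair \<open>R b\<close>, \<open>w\<close> of maps of cofree
  coalgebras from \<open>R Y\<close> to \<open>R (R Y)\<close>, split in \<open>D\<close> and coreflexive among coalgebras. A right
  adjoint of \<open>F\<close> must send the cofree coalgebra on \<open>Y\<close> to \<open>G Y\<close> and must preserve equalisers. Hence it
  must send \<open>B\<close> to the equaliser of a coreflexive pair from \<open>G Y\<close> to \<open>G (R Y)\<close>; conversely,
  that equaliser, if \<open>K\<close> has it, does the job (\<open>has_right_adjoint_into_Cog\<close>). This is the adjoint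
  triangle theorem for comonadic functors.

  Here \<open>K\<close> is itself a category of coalgebras for a comonad \<open>Q\<close> preserving coreflexive
  equalisers, so that it inherits these equalisers from the base (\<open>Cog_has_coreflexive_equalisers\<close>),
  and \<open>L\<close> is the forgetful functor followed by a base functor with a right adjoint, so that cofree
  coalgebras provide a right adjoint of \<open>L\<close> (\<open>forget_has_right_adjoint\<close>).\<close>

section \<open>Composable arrows\<close>

text \<open>The category laws are restated with side conditions on domains and codomains. In the form
  with hom-sets the intermediate objects occur only in the premises, which prevents conditional
  rewriting.\<close>

context category begin

lemma Comp_Arr: "\<lbrakk>f \<in> Arr C; g \<in> Arr C; Dom C g = Cod C f\<rbrakk> \<Longrightarrow> g \<cdot> f \<in> Arr C"
  and Dom_Comp: "\<lbrakk>f \<in> Arr C; g \<in> Arr C; Dom C g = Cod C f\<rbrakk> \<Longrightarrow> Dom C (g \<cdot> f) = Dom C f"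
  and Cod_Comp: "\<lbrakk>f \<in> Arr C; g \<in> Arr C; Dom C g = Cod C f\<rbrakk> \<Longrightarrow> Cod C (g \<cdot> f) = Cod C g"
  using Comp_in[of f "Dom C f" "Cod C f" g "Cod C g"] by (auto simp: hom_def)

lemma Comp_assoc_Arr:
  "\<lbrakk>f \<in> Arr C; g \<in> Arr C; h \<in> Arr C; Dom C g = Cod C f; Dom C h = Cod C g\<rbrakk>
    \<Longrightarrow> (h \<cdot> g) \<cdot> f = h \<cdot> g \<cdot> f"
  by (rule Comp_assoc[of f "Dom C f" "Cod C f" g "Cod C g" h "Cod C h"]) (auto simp: hom_def)

lemma Ident_Arr: "X \<in> Obj C \<Longrightarrow> Ident C X \<in> Arr C"
  and Dom_Ident: "X \<in> Obj C \<Longrightarrow> Dom C (Ident C X) = X"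
  and Cod_Ident: "X \<in> Obj C \<Longrightarrow> Cod C (Ident C X) = X"
  using Ident_in by (auto simp: hom_def)

lemma Ident_left_Arr: "\<lbrakk>f \<in> Arr C; Cod C f = X\<rbrakk> \<Longrightarrow> Ident C X \<cdot> f = f"
  and Ident_right_Arr: "\<lbrakk>f \<in> Arr C; Dom C f = X\<rbrakk> \<Longrightarrow> f \<cdot> Ident C X = f"
  using Ident_left[of f "Dom C f" "Cod C f"] Ident_right[of f "Dom C f" "Cod C f"]
  by (auto simp: hom_def)

lemmas arrows = Comp_Arr Dom_Comp Cod_Comp Comp_assoc_Arr Ident_Arr Dom_Ident Cod_Ident
  Ident_left_Arr Ident_right_Arr Dom_in Cod_in

end

lemma (in cat_functor)
  shows ar_Arr: "f \<in> Arr C \<Longrightarrow> ar F f \<in> Arr D"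
    and Dom_ar: "f \<in> Arr C \<Longrightarrow> Dom D (ar F f) = ob F (Dom C f)"
    and Cod_ar: "f \<in> Arr C \<Longrightarrow> Cod D (ar F f) = ob F (Cod C f)"
    and ar_Comp_Arr: "\<lbrakk>f \<in> Arr C; g \<in> Arr C; Dom C g = Cod C f\<rbrakk>
      \<Longrightarrow> ar F (g \<cdot>\<^bsub>C\<^esub> f) = ar F g \<cdot>\<^bsub>D\<^esub> ar F f"
  using ar_in[of f "Dom C f" "Cod C f"] ar_Comp[of f "Dom C f" "Cod C f" g "Cod C g"]
  by (auto simp: hom_def)

lemmas (in cat_functor) arrows = ar_Arr Dom_ar Cod_ar ar_Comp_Arr ar_Ident ob_in

lemma hom_D: "f \<in> hom C X Y \<Longrightarrow> f \<in> Arr C" "f \<in> hom C X Y \<Longrightarrow> Dom C f = X"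
  "f \<in> hom C X Y \<Longrightarrow> Cod C f = Y"
  by (auto simp: hom_def)

lemma homI: "\<lbrakk>f \<in> Arr C; Dom C f = X; Cod C f = Y\<rbrakk> \<Longrightarrow> f \<in> hom C X Y"
  by (simp add: hom_def)

lemma is_equaliser_mono:
  assumes "category C" and e: "is_equaliser C f g e"
    and h: "h \<in> hom C X (Dom C e)" "k \<in> hom C X (Dom C e)" "e \<cdot>\<^bsub>C\<^esub> h = e \<cdot>\<^bsub>C\<^esub> k"
  shows "h = k"
proof -
  interpret category C by fact
  have P: "f \<in> Arr C" "g \<in> Arr C" "Dom C g = Dom C f" "e \<in> Arr C" "Cod C e = Dom C f"
    "f \<cdot>\<^bsub>C\<^esub> e = g \<cdot>\<^bsub>C\<^esub> e"
    using e by (auto simp: is_equaliser_def parallel_def)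
  note a = hom_D[OF h(1)] hom_D[OF h(2)]
  have "f \<cdot>\<^bsub>C\<^esub> (e \<cdot>\<^bsub>C\<^esub> h) = g \<cdot>\<^bsub>C\<^esub> (e \<cdot>\<^bsub>C\<^esub> h)"
    using P a by (simp flip: Comp_assoc_Arr)
  moreover have "e \<cdot>\<^bsub>C\<^esub> h \<in> Arr C" "Cod C (e \<cdot>\<^bsub>C\<^esub> h) = Dom C f" "Dom C (e \<cdot>\<^bsub>C\<^esub> h) = X"
    using P a by (simp_all add: Comp_Arr Cod_Comp Dom_Comp)
  ultimately have "\<exists>!l. l \<in> hom C X (Dom C e) \<and> e \<cdot>\<^bsub>C\<^esub> l = e \<cdot>\<^bsub>C\<^esub> h"
    using e unfolding is_equaliser_def by blast
  then show ?thesis using h by metis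
qed

lemma is_equaliser_factor:
  assumes "is_equaliser C f g e" "h \<in> hom C X (Dom C f)" "f \<cdot>\<^bsub>C\<^esub> h = g \<cdot>\<^bsub>C\<^esub> h"
  obtains k where "k \<in> hom C X (Dom C e)" "e \<cdot>\<^bsub>C\<^esub> k = h"
proof -
  have "\<exists>!k. k \<in> hom C (Dom C h) (Dom C e) \<and> e \<cdot>\<^bsub>C\<^esub> k = h"
    using assms(1,3) hom_D[OF assms(2)] unfolding is_equaliser_def by blast
  then show thesis using that hom_D[OF assms(2)] by blast
qed

section \<open>Couniversal arrows and right adjoints\<close>

text \<open>The arrow \<open>p : F U \<rightarrow> Y\<close> is the component at \<open>Y\<close> of the counit of an adjunction, in other
  words a terminal object of the comma category of \<open>F\<close> over \<open>Y\<close>.\<close>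

definition couniversal ::
  "('o, 'm, 'x) cat_scheme \<Rightarrow> ('p, 'n, 'y) cat_scheme \<Rightarrow> ('o, 'm, 'p, 'n, 'z) func_scheme
    \<Rightarrow> 'o \<Rightarrow> 'n \<Rightarrow> 'p \<Rightarrow> bool" where
  "couniversal A B F U p Y \<longleftrightarrow> U \<in> Obj A \<and> p \<in> hom B (ob F U) Y \<and>
     (\<forall>X \<in> Obj A. \<forall>f \<in> hom B (ob F X) Y. \<exists>!g. g \<in> hom A X U \<and> p \<cdot>\<^bsub>B\<^esub> ar F g = f)"

text \<open>Right adjoints are handled pointwise; no functor is chosen until
  \<open>parametrised_right_adjoint\<close> does so for all parameters at once.\<close>

definition has_right_adjoint ::
  "('o, 'm, 'x) cat_scheme \<Rightarrow> ('p, 'n, 'y) cat_scheme \<Rightarrow> ('o, 'm, 'p, 'n, 'z) func_scheme \<Rightarrow> bool"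
  where
  "has_right_adjoint A B F \<longleftrightarrow> (\<forall>Y \<in> Obj B. \<exists>U p. couniversal A B F U p Y)"

lemma couniversal_arrow:
  assumes "couniversal A B F U p Y"
  shows "U \<in> Obj A" "p \<in> Arr B" "Dom B p = ob F U" "Cod B p = Y"
  using assms by (auto simp: couniversal_def hom_def)

lemma couniversal_factor:
  assumes "couniversal A B F U p Y" "X \<in> Obj A" "f \<in> hom B (ob F X) Y"
  obtains g where "g \<in> hom A X U" "p \<cdot>\<^bsub>B\<^esub> ar F g = f"
  using assms unfolding couniversal_def by blast

lemma couniversal_unique:
  assumes "cat_functor A B F" "couniversal A B F U p Y"
    and g: "g \<in> hom A X U" "h \<in> hom A X U" "p \<cdot>\<^bsub>B\<^esub> ar F g = p \<cdot>\<^bsub>B\<^esub> ar F h"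
  shows "g = h"
proof -
  interpret cat_functor A B F by fact
  note u = couniversal_arrow[OF assms(2)]
  have "p \<cdot>\<^bsub>B\<^esub> ar F g \<in> hom B (ob F X) Y" "X \<in> Obj A"
    using target.Comp_in[OF ar_in[OF g(1)]] u source.Dom_in hom_D[OF g(1)] by (auto simp: homI)
  then show ?thesis using assms(2) g unfolding couniversal_def by metis
qed

lemma couniversalI:
  assumes "U \<in> Obj A" "p \<in> hom B (ob F U) Y"
    and "\<And>X f. \<lbrakk>X \<in> Obj A; f \<in> hom B (ob F X) Y\<rbrakk> \<Longrightarrow> \<exists>g. g \<in> hom A X U \<and> p \<cdot>\<^bsub>B\<^esub> ar F g = f"
    and "\<And>X g h. \<lbrakk>g \<in> hom A X U; h \<in> hom A X U; p \<cdot>\<^bsub>B\<^esub> ar F g = p \<cdot>\<^bsub>B\<^esub> ar F h\<rbrakk> \<Longrightarrow> g = h"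
  shows "couniversal A B F U p Y"
  unfolding couniversal_def
proof (intro conjI ballI)
  fix X f assume "X \<in> Obj A" "f \<in> hom B (ob F X) Y"
  from assms(3)[OF this] assms(4) show "\<exists>!g. g \<in> hom A X U \<and> p \<cdot>\<^bsub>B\<^esub> ar F g = f" by metis
qed (use assms(1,2) in auto)

lemma has_right_adjoint_cong:
  assumes "has_right_adjoint A B F"
    and "\<And>X. X \<in> Obj A \<Longrightarrow> ob G X = ob F X" "\<And>f. f \<in> Arr A \<Longrightarrow> ar G f = ar F f"
  shows "has_right_adjoint A B G"
proof -
  have "couniversal A B F U p Y \<Longrightarrow> couniversal A B G U p Y" for U p Y
    using assms(2,3) by (auto simp: couniversal_def hom_def cong: conj_cong)
  then show ?thesis using assms(1) unfolding has_right_adjoint_def by blast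
qed

text \<open>The Yoneda argument: the couniversal arrow is the one that corresponds to the identity.\<close>

lemma natural_bij_has_right_adjoint:
  assumes "cat_functor A B F"
    and U: "\<And>Y. Y \<in> Obj B \<Longrightarrow> U Y \<in> Obj A"
    and bij: "\<And>X Y. \<lbrakk>X \<in> Obj A; Y \<in> Obj B\<rbrakk>
      \<Longrightarrow> bij_betw (\<theta> X Y) (hom B (ob F X) Y) (hom A X (U Y))"
    and nat: "\<And>x X' X Y f. \<lbrakk>x \<in> hom A X' X; Y \<in> Obj B; f \<in> hom B (ob F X) Y\<rbrakk>
      \<Longrightarrow> \<theta> X' Y (f \<cdot>\<^bsub>B\<^esub> ar F x) = \<theta> X Y f \<cdot>\<^bsub>A\<^esub> x"
  shows "has_right_adjoint A B F"
  unfolding has_right_adjoint_def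
proof
  interpret cat_functor A B F by fact
  fix Y assume Y: "Y \<in> Obj B"
  note UY = U[OF Y]
  obtain p where p: "p \<in> hom B (ob F (U Y)) Y" "\<theta> (U Y) Y p = Ident A (U Y)"
    using bij[OF UY Y] source.Ident_in[OF UY] by (metis bij_betw_iff_bijections)
  have key: "\<theta> X Y (p \<cdot>\<^bsub>B\<^esub> ar F g) = g" if "g \<in> hom A X (U Y)" for X g
    using nat[OF that Y p(1)] p source.Ident_left[OF that] by simp
  have "couniversal A B F (U Y) p Y"
  proof (rule couniversalI[OF UY p(1)])
    fix X f assume X: "X \<in> Obj A" and f: "f \<in> hom B (ob F X) Y"
    have t: "\<theta> X Y f \<in> hom A X (U Y)" using bij[OF X Y] f by (auto simp: bij_betw_def)
    have "p \<cdot>\<^bsub>B\<^esub> ar F (\<theta> X Y f) \<in> hom B (ob F X) Y"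
      by (rule target.Comp_in[OF ar_in[OF t] p(1)])
    then have "p \<cdot>\<^bsub>B\<^esub> ar F (\<theta> X Y f) = f"
      using bij[OF X Y] f key[OF t] by (auto simp: bij_betw_def dest: inj_onD)
    then show "\<exists>g. g \<in> hom A X (U Y) \<and> p \<cdot>\<^bsub>B\<^esub> ar F g = f" using t by blast
  qed (metis key)
  then show "\<exists>U p. couniversal A B F U p Y" by blast
qed

lemma cat_functor_comp_func:
  assumes "cat_functor A B F" "cat_functor B E G"
  shows "cat_functor A E (comp_func G F)"
proof -
  interpret F: cat_functor A B F by fact
  interpret G: cat_functor B E G by fact
  show ?thesis
    by unfold_locales
      (auto simp: comp_func_def F.arrows G.arrows hom_def)
qed

lemma has_right_adjoint_comp_func:
  assumes "cat_functor A B F" "cat_functor B E G"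
    and "has_right_adjoint A B F" "has_right_adjoint B E G"
  shows "has_right_adjoint A E (comp_func G F)"
  unfolding has_right_adjoint_def
proof
  interpret F: cat_functor A B F by fact
  interpret G: cat_functor B E G by fact
  note [simp] = comp_func_def F.arrows G.arrows G.target.arrows
  fix Y assume "Y \<in> Obj E"
  then obtain V q where q: "couniversal B E G V q Y"
    using assms(4) by (auto simp: has_right_adjoint_def)
  note q' = couniversal_arrow[OF q]
  obtain U p where p: "couniversal A B F U p V"
    using assms(3) q' by (auto simp: has_right_adjoint_def)
  note p' = couniversal_arrow[OF p]
  have eq: "(q \<cdot>\<^bsub>E\<^esub> ar G p) \<cdot>\<^bsub>E\<^esub> ar (comp_func G F) g = q \<cdot>\<^bsub>E\<^esub> ar G (p \<cdot>\<^bsub>B\<^esub> ar F g)"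
    if "g \<in> hom A X U" for g X
    using hom_D[OF that] p' q' by simp
  have "couniversal A E (comp_func G F) U (q \<cdot>\<^bsub>E\<^esub> ar G p) Y"
  proof (rule couniversalI)
    show "U \<in> Obj A" by fact
    show "q \<cdot>\<^bsub>E\<^esub> ar G p \<in> hom E (ob (comp_func G F) U) Y" using p' q' by (simp add: hom_def)
  next
    fix X f assume X: "X \<in> Obj A" and f: "f \<in> hom E (ob (comp_func G F) X) Y"
    obtain g where g: "g \<in> hom B (ob F X) V" "q \<cdot>\<^bsub>E\<^esub> ar G g = f"
      using couniversal_factor[OF q F.ob_in[OF X]] f by auto
    obtain h where "h \<in> hom A X U" "p \<cdot>\<^bsub>B\<^esub> ar F h = g"
      using couniversal_factor[OF p X g(1)] by auto
    then show "\<exists>g. g \<in> hom A X U \<and> (q \<cdot>\<^bsub>E\<^esub> ar G p) \<cdot>\<^bsub>E\<^esub> ar (comp_func G F) g = f"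
      using eq g by metis
  next
    fix X g h
    assume gh: "g \<in> hom A X U" "h \<in> hom A X U"
      "(q \<cdot>\<^bsub>E\<^esub> ar G p) \<cdot>\<^bsub>E\<^esub> ar (comp_func G F) g = (q \<cdot>\<^bsub>E\<^esub> ar G p) \<cdot>\<^bsub>E\<^esub> ar (comp_func G F) h"
    have pg: "p \<cdot>\<^bsub>B\<^esub> ar F k \<in> hom B (ob F X) V" if "k \<in> hom A X U" for k
      using F.target.Comp_in[OF F.ar_in[OF that]] p' by (auto simp: homI)
    have "p \<cdot>\<^bsub>B\<^esub> ar F g = p \<cdot>\<^bsub>B\<^esub> ar F h"
      using couniversal_unique[OF assms(2) q pg[OF gh(1)] pg[OF gh(2)]] gh eq by metis
    then show "g = h" using couniversal_unique[OF assms(1) p gh(1,2)] by simp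
  qed
  then show "\<exists>U p. couniversal A E (comp_func G F) U p Y" by blast
qed

section \<open>The category of coalgebras\<close>

lemma Cog_sel: "Dom (Cog C Q) (A, f, B) = A" "Cod (Cog C Q) (A, f, B) = B"
  "Obj (Cog C Q) = Collect (is_coalgebra C Q)" "Ident (Cog C Q) A = (A, Ident C (fst A), A)"
  "(A, f, B) \<in> Arr (Cog C Q)
    \<longleftrightarrow> is_coalgebra C Q A \<and> is_coalgebra C Q B \<and> is_coalgebra_map C Q A f B"
  by (auto simp: Cog_def)

lemma is_coalgebra_mapD:
  assumes "is_coalgebra_map C Q A f B"
  shows "f \<in> hom C (fst A) (fst B)" "snd B \<cdot>\<^bsub>C\<^esub> f = ar Q f \<cdot>\<^bsub>C\<^esub> snd A"
  using assms by (auto simp: is_coalgebra_map_def split: prod.splits)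

lemma is_coalgebraD:
  assumes "is_coalgebra C Q A"
  shows "fst A \<in> Obj C" "snd A \<in> hom C (fst A) (ob Q (fst A))"
    "counit Q (fst A) \<cdot>\<^bsub>C\<^esub> snd A = Ident C (fst A)"
    "comult Q (fst A) \<cdot>\<^bsub>C\<^esub> snd A = ar Q (snd A) \<cdot>\<^bsub>C\<^esub> snd A"
  using assms by (auto simp: is_coalgebra_def split: prod.splits)

context comonad begin

lemma comult_arrow: "X \<in> Obj C \<Longrightarrow> comult Q X \<in> Arr C"
  "X \<in> Obj C \<Longrightarrow> Dom C (comult Q X) = ob Q X"
  "X \<in> Obj C \<Longrightarrow> Cod C (comult Q X) = ob Q (ob Q X)"
  using comult.component_in by (auto simp: hom_def comp_func_def)

lemma counit_arrow: "X \<in> Obj C \<Longrightarrow> counit Q X \<in> Arr C"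
  "X \<in> Obj C \<Longrightarrow> Dom C (counit Q X) = ob Q X"
  "X \<in> Obj C \<Longrightarrow> Cod C (counit Q X) = X"
  using counit.component_in by (auto simp: hom_def id_func_def)

lemma cat_functor_forget: "cat_functor (Cog C Q) C forget"
proof -
  interpret K: category "Cog C Q" by (rule category_Cog)
  show ?thesis
    by unfold_locales
      (auto simp: forget_def Cog_sel hom_Cog Comp_Cog dest: is_coalgebra_mapD is_coalgebraD)
qed

lemma cofree_coalgebra: "X \<in> Obj C \<Longrightarrow> is_coalgebra C Q (ob Q X, comult Q X)"
  using ob_in comult.component_in[of X] counit_left coassoc
  by (simp add: is_coalgebra_def comp_func_def)

text \<open>The couniversal arrow is the counit \<open>n : Q Y \<rightarrow> Y\<close> out of the cofree coalgebra. A map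
  \<open>f : V \<rightarrow> Y\<close> on the underlying object of a coalgebra \<open>(V, a)\<close> corresponds to \<open>Q f \<cdot> a\<close>.\<close>

lemma forget_has_right_adjoint: "has_right_adjoint (Cog C Q) C forget"
  unfolding has_right_adjoint_def
proof
  fix Y assume Y: "Y \<in> Obj C"
  let ?U = "(ob Q Y, comult Q Y)"
  note [simp] = source.arrows arrows
  note w = comult_arrow and n = counit_arrow
  \<comment> \<open>A coalgebra map into a cofree coalgebra is determined by its composite with the counit.\<close>
  have recover: "ar Q (counit Q Y \<cdot> g) \<cdot> snd A = g"
    if A: "is_coalgebra C Q A" and g: "is_coalgebra_map C Q A g ?U" for A g
  proof -
    note a = is_coalgebraD[OF A] and g' = is_coalgebra_mapD[OF g]
    note t = hom_D[OF a(2)] hom_D[OF g'(1)] 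
    have "ar Q (counit Q Y \<cdot> g) \<cdot> snd A = ar Q (counit Q Y) \<cdot> (ar Q g \<cdot> snd A)"
      using a t w[OF Y] n[OF Y] by simp
    also have "\<dots> = (ar Q (counit Q Y) \<cdot> comult Q Y) \<cdot> g"
      using g'(2) t w[OF Y] n[OF Y] by simp
    finally show ?thesis using counit_right[OF Y] t by simp
  qed
  have "couniversal (Cog C Q) C forget ?U (counit Q Y) Y"
  proof (rule couniversalI)
    show "?U \<in> Obj (Cog C Q)" using cofree_coalgebra[OF Y] by (simp add: Cog_sel)
    show "counit Q Y \<in> hom C (ob forget ?U) Y" using n[OF Y] by (simp add: forget_def hom_def)
  next
    fix A f assume A: "A \<in> Obj (Cog C Q)" and f: "f \<in> hom C (ob forget A) Y"
    note a = is_coalgebraD[OF A[unfolded Cog_sel, simplified]]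
    note t = hom_D[OF a(2)] hom_D[OF f[unfolded forget_def, simplified]]
    let ?g = "ar Q f \<cdot> snd A"
    have "comult Q Y \<cdot> ?g = (comult Q Y \<cdot> ar Q f) \<cdot> snd A"
      using a t w[OF Y] by simp
    also have "\<dots> = ar Q (ar Q f) \<cdot> (comult Q (fst A) \<cdot> snd A)"
      using comult.natural[of f "fst A" Y] f a t w[OF a(1)] by (simp add: forget_def comp_func_def)
    also have "\<dots> = ar Q ?g \<cdot> snd A" using a t by simp
    finally have 1: "is_coalgebra_map C Q A ?g ?U"
      using a t by (cases A) (simp add: is_coalgebra_map_def hom_def)
    have "counit Q Y \<cdot> ?g = (counit Q Y \<cdot> ar Q f) \<cdot> snd A"
      using a t n[OF Y] by simp
    also have "\<dots> = f \<cdot> (counit Q (fst A) \<cdot> snd A)"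
      using counit.natural[of f "fst A" Y] f a(1) t n[OF a(1)] by (simp add: forget_def id_func_def)
    finally have "counit Q Y \<cdot> ?g = f" using a t by simp
    then show "\<exists>g. g \<in> hom (Cog C Q) A ?U \<and> counit Q Y \<cdot> ar forget g = f"
      using 1 A cofree_coalgebra[OF Y]
      by (intro exI[of _ "(A, ?g, ?U)"]) (simp add: hom_Cog forget_def Cog_sel)
  next
    fix A g h
    assume "g \<in> hom (Cog C Q) A ?U" "h \<in> hom (Cog C Q) A ?U"
      and eq: "counit Q Y \<cdot> ar forget g = counit Q Y \<cdot> ar forget h"
    obtain g' h' where gh: "g = (A, g', ?U)" "h = (A, h', ?U)" "is_coalgebra C Q A"
      "is_coalgebra_map C Q A g' ?U" "is_coalgebra_map C Q A h' ?U"
      using \<open>g \<in> _\<close> \<open>h \<in> _\<close> unfolding hom_Cog by auto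
    have "counit Q Y \<cdot> g' = counit Q Y \<cdot> h'" using eq unfolding gh forget_def by simp
    then have "g' = h'" using recover[OF gh(3,4)] recover[OF gh(3,5)] by metis
    then show "g = h" by (simp only: gh)
  qed
  then show "\<exists>U p. couniversal (Cog C Q) C forget U p Y" by blast
qed

text \<open>Let \<open>e : E \<rightarrow> V\<close> be the equaliser in \<open>C\<close> of the underlying pair. Since \<open>Q e\<close> is again an
  equaliser, the coaction \<open>a\<close> of \<open>V\<close> restricts to some \<open>d : E \<rightarrow> Q E\<close>. The axioms for \<open>d\<close> hold after
  composition with \<open>e\<close> and \<open>Q Q e\<close> respectively, and both are monic: the image under \<open>Q\<close> of a
  coreflexive pair is coreflexive, so \<open>Q Q e\<close> is an equaliser as well.\<close>

lemma Cog_has_coreflexive_equalisers: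
  assumes has: "has_coreflexive_equalisers C" and pres: "preserves_coreflexive_equalisers C C Q"
  shows "has_coreflexive_equalisers (Cog C Q)"
  unfolding has_coreflexive_equalisers_def
proof (intro allI impI)
  note [simp] = source.arrows arrows
  note w = comult_arrow and n = counit_arrow
  fix F G assume FG: "coreflexive_pair (Cog C Q) F G"
  then obtain A f B g r where F: "F = (A, f, B)" "G = (A, g, B)"
    and A: "is_coalgebra C Q A" and B: "is_coalgebra C Q B"
    and f: "is_coalgebra_map C Q A f B" and g: "is_coalgebra_map C Q A g B"
    and r: "is_coalgebra_map C Q B r A" and rf: "r \<cdot> f = Ident C (fst A)" "r \<cdot> g = Ident C (fst A)"
    by (cases F; cases G)
      (auto simp: coreflexive_pair_def parallel_def Cog_sel hom_Cog Comp_Cog)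
  note a = is_coalgebraD[OF A] and b = is_coalgebraD[OF B]
    and f' = is_coalgebra_mapD[OF f] and g' = is_coalgebra_mapD[OF g] and r' = is_coalgebra_mapD[OF r]
  note t = hom_D[OF a(2)] hom_D[OF b(2)] hom_D[OF f'(1)] hom_D[OF g'(1)] hom_D[OF r'(1)]
  have cr: "coreflexive_pair C f g" using r' rf t by (auto simp: coreflexive_pair_def parallel_def)
  then obtain e where e: "is_equaliser C f g e" using has by (auto simp: has_coreflexive_equalisers_def)
  have Qe: "is_equaliser C (ar Q f) (ar Q g) (ar Q e)"
    using cr e pres by (auto simp: preserves_coreflexive_equalisers_def)
  have "ar Q r \<in> hom C (ob Q (fst B)) (ob Q (fst A))" "ar Q r \<cdot> ar Q f = Ident C (ob Q (fst A))"
    "ar Q r \<cdot> ar Q g = Ident C (ob Q (fst A))"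
    using ar_in[OF r'(1)] ar_Comp[OF f'(1) r'(1)] ar_Comp[OF g'(1) r'(1)] rf a by auto
  then have "coreflexive_pair C (ar Q f) (ar Q g)"
    using t by (auto simp: coreflexive_pair_def parallel_def)
  then have QQe: "is_equaliser C (ar Q (ar Q f)) (ar Q (ar Q g)) (ar Q (ar Q e))"
    using Qe pres by (auto simp: preserves_coreflexive_equalisers_def)
  define E where "E = Dom C e"
  have e': "e \<in> Arr C" "Dom C e = E" "Cod C e = fst A" "f \<cdot> e = g \<cdot> e" "E \<in> Obj C"
    using e t source.Dom_in by (auto simp: is_equaliser_def E_def)
  note mono = is_equaliser_mono[OF source.category_axioms e]
    and Qmono = is_equaliser_mono[OF source.category_axioms Qe]
    and QQmono = is_equaliser_mono[OF source.category_axioms QQe]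
  have "ar Q f \<cdot> (snd A \<cdot> e) = (ar Q f \<cdot> snd A) \<cdot> e" using t e' by simp
  also have "\<dots> = snd B \<cdot> (f \<cdot> e)" using f'(2)[symmetric] t e'(1-3) by simp
  also have "\<dots> = (snd B \<cdot> g) \<cdot> e" using t e' by simp
  also have "\<dots> = ar Q g \<cdot> (snd A \<cdot> e)" unfolding g'(2) using t e' by simp
  finally obtain d where d: "d \<in> hom C E (ob Q E)" "ar Q e \<cdot> d = snd A \<cdot> e"
    using is_equaliser_factor[OF Qe homI[of "snd A \<cdot> e" C E]] t e' by auto
  note d' = hom_D[OF d(1)]
  have "e \<cdot> (counit Q E \<cdot> d) = (counit Q (fst A) \<cdot> ar Q e) \<cdot> d"
    using counit.natural[of e E "fst A"] e' d' n[OF e'(5)] by (simp add: id_func_def hom_def)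
  also have "\<dots> = counit Q (fst A) \<cdot> (snd A \<cdot> e)" using d e' d' n[OF a(1)] by simp
  also have "\<dots> = (counit Q (fst A) \<cdot> snd A) \<cdot> e" using e' t n[OF a(1)] by simp
  also have "\<dots> = e \<cdot> Ident C E" using a e' by simp
  finally have cu: "counit Q E \<cdot> d = Ident C E"
    by (rule mono[of _ E, rotated 2]) (use e' d' n[OF e'(5)] in \<open>auto simp: hom_def\<close>)
  have "ar Q (ar Q e) \<cdot> (comult Q E \<cdot> d) = (comult Q (fst A) \<cdot> ar Q e) \<cdot> d"
    using comult.natural[of e E "fst A"] e' d' w[OF e'(5)] by (simp add: comp_func_def hom_def)
  also have "\<dots> = comult Q (fst A) \<cdot> (snd A \<cdot> e)" using d e' d' w[OF a(1)] by simp
  also have "\<dots> = (comult Q (fst A) \<cdot> snd A) \<cdot> e" using e' t w[OF a(1)] by simp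
  also have "\<dots> = ar Q (snd A) \<cdot> (snd A \<cdot> e)" unfolding a(4) using e' t by simp
  also have "\<dots> = (ar Q (snd A) \<cdot> ar Q e) \<cdot> d" unfolding d(2)[symmetric] using e' d' t by simp
  also have "\<dots> = ar Q (ar Q e \<cdot> d) \<cdot> d" unfolding d(2) using e' t by simp
  also have "\<dots> = ar Q (ar Q e) \<cdot> (ar Q d \<cdot> d)" using e' d' by simp
  finally have co: "comult Q E \<cdot> d = ar Q d \<cdot> d"
    by (rule QQmono[of _ E, rotated 2]) (use e' d' w[OF e'(5)] in \<open>auto simp: hom_def\<close>)
  have Ed: "is_coalgebra C Q (E, d)" using cu co d e' by (simp add: is_coalgebra_def)
  have em: "is_coalgebra_map C Q (E, d) e A"
    using e' d by (cases A) (simp add: is_coalgebra_map_def hom_def)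
  have "is_equaliser (Cog C Q) F G ((E, d), e, A)"
    unfolding is_equaliser_def
  proof (intro conjI ballI impI)
    show "parallel (Cog C Q) F G" using FG by (simp add: coreflexive_pair_def)
    show "((E, d), e, A) \<in> Arr (Cog C Q)" using Ed A em by (simp add: Cog_sel)
    show "Cod (Cog C Q) ((E, d), e, A) = Dom (Cog C Q) F"
      "F \<cdot>\<^bsub>Cog C Q\<^esub> ((E, d), e, A) = G \<cdot>\<^bsub>Cog C Q\<^esub> ((E, d), e, A)"
      using e' by (simp_all add: F Cog_sel Comp_Cog)
  next
    fix H assume H: "H \<in> Arr (Cog C Q)"
      "Cod (Cog C Q) H = Dom (Cog C Q) F \<and> F \<cdot>\<^bsub>Cog C Q\<^esub> H = G \<cdot>\<^bsub>Cog C Q\<^esub> H"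
    then obtain X h where h: "H = (X, h, A)" "is_coalgebra C Q X" "is_coalgebra_map C Q X h A"
      "f \<cdot> h = g \<cdot> h"
      by (cases H) (auto simp: F Cog_sel Comp_Cog)
    note x = is_coalgebraD[OF h(2)] and h' = is_coalgebra_mapD[OF h(3)]
    obtain k where k: "k \<in> hom C (fst X) E" "e \<cdot> k = h"
      using is_equaliser_factor[OF e, of h "fst X"] h h' t e' by auto
    note t' = hom_D[OF x(2)] hom_D[OF h'(1)] hom_D[OF k(1)]
    have "ar Q e \<cdot> (d \<cdot> k) = (ar Q e \<cdot> d) \<cdot> k" using e' d' t' by simp
    also have "\<dots> = snd A \<cdot> h" unfolding d(2) k(2)[symmetric] using e' t t' by simp
    also have "\<dots> = ar Q (e \<cdot> k) \<cdot> snd X" by (simp add: h' k)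
    also have "\<dots> = ar Q e \<cdot> (ar Q k \<cdot> snd X)" using e' t' by simp
    finally have "d \<cdot> k = ar Q k \<cdot> snd X"
      by (rule Qmono[of _ "fst X", rotated 2]) (use e' d' t' in \<open>auto simp: hom_def\<close>)
    then have km: "is_coalgebra_map C Q X k (E, d)" using k by (cases X) (simp add: is_coalgebra_map_def)
    have "l = (X, k, (E, d))"
      if l: "l \<in> hom (Cog C Q) X (E, d)" "((E, d), e, A) \<cdot>\<^bsub>Cog C Q\<^esub> l = H" for l
    proof -
      obtain j where j: "l = (X, j, (E, d))" "is_coalgebra_map C Q X j (E, d)" "e \<cdot> j = h"
        using l by (auto simp: hom_Cog Comp_Cog h)
      have "j = k" using mono[of j "fst X" k] is_coalgebra_mapD[OF j(2)] k j e' by simp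
      then show ?thesis by (simp add: j)
    qed
    then show "\<exists>!l. l \<in> hom (Cog C Q) (Dom (Cog C Q) H) (Dom (Cog C Q) ((E, d), e, A)) \<and>
        ((E, d), e, A) \<cdot>\<^bsub>Cog C Q\<^esub> l = H"
      using h Ed km k by (intro ex1I[of _ "(X, k, (E, d))"]) (auto simp: Cog_sel hom_Cog Comp_Cog)
  qed
  then show "\<exists>e. is_equaliser (Cog C Q) F G e" by blast
qed

end

section \<open>Lifting right adjoints to coalgebras\<close>

text \<open>Let \<open>L\<close> be the underlying functor of \<open>F\<close>, let \<open>\<sigma> X\<close> be the coaction on \<open>L X\<close>, and let
  \<open>p : L U \<rightarrow> Y\<close> be couniversal. Maps \<open>f : L X \<rightarrow> Y\<close> correspond to arrows \<open>g : X \<rightarrow> U\<close>. Such an \<open>f\<close>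
  is a coalgebra map to \<open>(Y, b)\<close> precisely when \<open>b \<cdot> f\<close> and \<open>R f \<cdot> \<sigma> X\<close> agree. Both are natural
  in \<open>X\<close>, so for \<open>U2\<close> couniversal over \<open>R Y\<close> they correspond to \<open>s \<cdot> g\<close> and \<open>t \<cdot> g\<close> for fixed arrows
  \<open>s, t : U \<rightarrow> U2\<close>; composition with the counit \<open>n : R Y \<rightarrow> Y\<close> takes both \<open>b \<cdot> f\<close> and \<open>R f \<cdot> \<sigma> X\<close>
  back to \<open>f\<close> and hence yields a common retraction \<open>r\<close>. So coalgebra maps \<open>F X \<rightarrow> (Y, b)\<close> are the
  same as arrows from \<open>X\<close> to the equaliser of \<open>s\<close> and \<open>t\<close>.\<close>

lemma has_right_adjoint_into_Cog:
  assumes "comonad D R" and "cat_functor K (Cog D R) F"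
    and has: "has_coreflexive_equalisers K"
    and adj: "has_right_adjoint K D (comp_func forget F)"
  shows "has_right_adjoint K (Cog D R) F"
  unfolding has_right_adjoint_def
proof
  interpret R: comonad D R by fact
  interpret F: cat_functor K "Cog D R" F by fact
  interpret forget: cat_functor "Cog D R" D forget by (rule R.cat_functor_forget)
  define L where "L = comp_func forget F"
  interpret L: cat_functor K D L
    unfolding L_def by (rule cat_functor_comp_func) unfold_locales
  note [simp] = R.source.arrows R.arrows F.source.arrows L.arrows
  define \<sigma> where "\<sigma> X = snd (ob F X)" for X
  have coalg: "is_coalgebra D R (ob F X)" "ob F X = (ob L X, \<sigma> X)" if "X \<in> Obj K" for X
    using F.ob_in[OF that] by (simp_all add: Cog_sel L_def \<sigma>_def comp_func_def forget_def)
  have \<sigma>: "\<sigma> X \<in> Arr D" "Dom D (\<sigma> X) = ob L X" "Cod D (\<sigma> X) = ob R (ob L X)"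
    "counit R (ob L X) \<cdot>\<^bsub>D\<^esub> \<sigma> X = Ident D (ob L X)" if "X \<in> Obj K" for X
    using is_coalgebraD[OF coalg(1)[OF that]] coalg(2)[OF that] by (auto simp: hom_def)
  have F_ar: "ar F g = (ob F X, ar L g, ob F Z)" and
    F_map: "\<sigma> Z \<cdot>\<^bsub>D\<^esub> ar L g = ar R (ar L g) \<cdot>\<^bsub>D\<^esub> \<sigma> X" if "g \<in> hom K X Z" for g X Z
  proof -
    show 1: "ar F g = (ob F X, ar L g, ob F Z)"
      using F.ar_in[OF that] by (auto simp: hom_Cog L_def comp_func_def forget_def)
    show "\<sigma> Z \<cdot>\<^bsub>D\<^esub> ar L g = ar R (ar L g) \<cdot>\<^bsub>D\<^esub> \<sigma> X"
      using F.ar_in[OF that] unfolding hom_Cog by (auto simp: 1 \<sigma>_def dest: is_coalgebra_mapD)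
  qed
  fix B assume "B \<in> Obj (Cog D R)"
  then have B: "is_coalgebra D R B" by (simp add: Cog_sel)
  obtain Y b where Bd: "B = (Y, b)" by (cases B)
  note b = is_coalgebraD[OF B, unfolded Bd fst_conv snd_conv]
  have Y: "Y \<in> Obj D" and bt: "b \<in> Arr D" "Dom D b = Y" "Cod D b = ob R Y" using b by (auto simp: hom_def)
  have RY: "ob R Y \<in> Obj D" by (rule R.ob_in[OF Y])
  note n = R.counit_arrow[OF Y]
  obtain U p where p: "couniversal K D L U p Y"
    using adj Y by (auto simp: has_right_adjoint_def L_def)
  obtain U2 p2 where p2: "couniversal K D L U2 p2 (ob R Y)"
    using adj RY by (auto simp: has_right_adjoint_def L_def)
  note p' = couniversal_arrow[OF p] and p2' = couniversal_arrow[OF p2]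
  obtain s where s: "s \<in> hom K U U2" "p2 \<cdot>\<^bsub>D\<^esub> ar L s = b \<cdot>\<^bsub>D\<^esub> p"
    using couniversal_factor[OF p2 p'(1), of "b \<cdot>\<^bsub>D\<^esub> p"] p' bt by (auto simp: hom_def)
  obtain t where t: "t \<in> hom K U U2" "p2 \<cdot>\<^bsub>D\<^esub> ar L t = ar R p \<cdot>\<^bsub>D\<^esub> \<sigma> U"
    using couniversal_factor[OF p2 p'(1), of "ar R p \<cdot>\<^bsub>D\<^esub> \<sigma> U"] p' \<sigma>[OF p'(1)] by (auto simp: hom_def)
  obtain r where r: "r \<in> hom K U2 U" "p \<cdot>\<^bsub>D\<^esub> ar L r = counit R Y \<cdot>\<^bsub>D\<^esub> p2"
    using couniversal_factor[OF p p2'(1), of "counit R Y \<cdot>\<^bsub>D\<^esub> p2"] p2' n by (auto simp: hom_def)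
  note st = hom_D[OF s(1)] hom_D[OF t(1)] hom_D[OF r(1)]
  have s_post: "p2 \<cdot>\<^bsub>D\<^esub> ar L (s \<cdot>\<^bsub>K\<^esub> g) = b \<cdot>\<^bsub>D\<^esub> (p \<cdot>\<^bsub>D\<^esub> ar L g)"
    and t_post: "p2 \<cdot>\<^bsub>D\<^esub> ar L (t \<cdot>\<^bsub>K\<^esub> g) = ar R (p \<cdot>\<^bsub>D\<^esub> ar L g) \<cdot>\<^bsub>D\<^esub> \<sigma> X"
    if g: "g \<in> hom K X U" for g X
  proof -
    note g' = hom_D[OF g]
    have X: "X \<in> Obj K" using F.source.Dom_in[OF g'(1)] g' by simp
    have "p2 \<cdot>\<^bsub>D\<^esub> ar L (s \<cdot>\<^bsub>K\<^esub> g) = (p2 \<cdot>\<^bsub>D\<^esub> ar L s) \<cdot>\<^bsub>D\<^esub> ar L g" using g' st p2' by simp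
    then show "p2 \<cdot>\<^bsub>D\<^esub> ar L (s \<cdot>\<^bsub>K\<^esub> g) = b \<cdot>\<^bsub>D\<^esub> (p \<cdot>\<^bsub>D\<^esub> ar L g)"
      unfolding s(2) using g' p' bt by simp
    have "p2 \<cdot>\<^bsub>D\<^esub> ar L (t \<cdot>\<^bsub>K\<^esub> g) = (p2 \<cdot>\<^bsub>D\<^esub> ar L t) \<cdot>\<^bsub>D\<^esub> ar L g" using g' st p2' by simp
    also have "\<dots> = ar R p \<cdot>\<^bsub>D\<^esub> (\<sigma> U \<cdot>\<^bsub>D\<^esub> ar L g)" unfolding t(2) using g' p' \<sigma>[OF p'(1)] by simp
    finally show "p2 \<cdot>\<^bsub>D\<^esub> ar L (t \<cdot>\<^bsub>K\<^esub> g) = ar R (p \<cdot>\<^bsub>D\<^esub> ar L g) \<cdot>\<^bsub>D\<^esub> \<sigma> X"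
      unfolding F_map[OF g] using g' p' \<sigma>[OF X] by simp
  qed
  have r_post: "p \<cdot>\<^bsub>D\<^esub> ar L (r \<cdot>\<^bsub>K\<^esub> h) = counit R Y \<cdot>\<^bsub>D\<^esub> (p2 \<cdot>\<^bsub>D\<^esub> ar L h)"
    if h: "h \<in> hom K X U2" for h X
  proof -
    have "p \<cdot>\<^bsub>D\<^esub> ar L (r \<cdot>\<^bsub>K\<^esub> h) = (p \<cdot>\<^bsub>D\<^esub> ar L r) \<cdot>\<^bsub>D\<^esub> ar L h" using hom_D[OF h] st p' by simp
    then show ?thesis unfolding r(2) using hom_D[OF h] p2' n by simp
  qed
  have IU: "Ident K U \<in> hom K U U" using p' by (simp add: F.source.Ident_in)
  have "p \<cdot>\<^bsub>D\<^esub> ar L (r \<cdot>\<^bsub>K\<^esub> s) = counit R Y \<cdot>\<^bsub>D\<^esub> (b \<cdot>\<^bsub>D\<^esub> p)" using r_post[OF s(1)] s by simp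
  also have "\<dots> = (counit R Y \<cdot>\<^bsub>D\<^esub> b) \<cdot>\<^bsub>D\<^esub> p" using n bt p' by simp
  also have "\<dots> = p \<cdot>\<^bsub>D\<^esub> ar L (Ident K U)" unfolding b(3) using p' by simp
  finally have rs: "r \<cdot>\<^bsub>K\<^esub> s = Ident K U"
    by (intro couniversal_unique[OF L.cat_functor_axioms p _ IU]) (use st in \<open>simp_all add: hom_def\<close>)
  have "p \<cdot>\<^bsub>D\<^esub> ar L (r \<cdot>\<^bsub>K\<^esub> t) = counit R Y \<cdot>\<^bsub>D\<^esub> (ar R p \<cdot>\<^bsub>D\<^esub> \<sigma> U)" using r_post[OF t(1)] t by simp
  also have "\<dots> = (counit R Y \<cdot>\<^bsub>D\<^esub> ar R p) \<cdot>\<^bsub>D\<^esub> \<sigma> U" using n p' \<sigma>[OF p'(1)] by simp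
  also have "counit R Y \<cdot>\<^bsub>D\<^esub> ar R p = p \<cdot>\<^bsub>D\<^esub> counit R (ob L U)"
    using R.counit.natural[of p "ob L U" Y] p' by (simp add: hom_def id_func_def)
  also have "\<dots> \<cdot>\<^bsub>D\<^esub> \<sigma> U = p \<cdot>\<^bsub>D\<^esub> (counit R (ob L U) \<cdot>\<^bsub>D\<^esub> \<sigma> U)"
    using R.counit.component_in[OF L.ob_in[OF p'(1)]] p' \<sigma>(1-3)[OF p'(1)] by (simp add: hom_def id_func_def)
  also have "\<dots> = p \<cdot>\<^bsub>D\<^esub> ar L (Ident K U)" using \<sigma>(4)[OF p'(1)] p' by simp
  finally have rt: "r \<cdot>\<^bsub>K\<^esub> t = Ident K U"
    by (intro couniversal_unique[OF L.cat_functor_axioms p _ IU]) (use st in \<open>simp_all add: hom_def\<close>)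
  have "coreflexive_pair K s t"
    using st r(1) rs rt by (auto simp: coreflexive_pair_def parallel_def)
  then obtain i where i: "is_equaliser K s t i" using has by (auto simp: has_coreflexive_equalisers_def)
  define E where "E = Dom K i"
  have i': "i \<in> hom K E U" "s \<cdot>\<^bsub>K\<^esub> i = t \<cdot>\<^bsub>K\<^esub> i" and E: "E \<in> Obj K"
    using i st F.source.Dom_in[of i] by (auto simp: is_equaliser_def hom_def E_def)
  note it = hom_D[OF i'(1)]
  have coalg_map: "is_coalgebra_map D R (ob F X) (p \<cdot>\<^bsub>D\<^esub> ar L g) B \<longleftrightarrow> s \<cdot>\<^bsub>K\<^esub> g = t \<cdot>\<^bsub>K\<^esub> g"
    if g: "g \<in> hom K X U" for g X
  proof -
    note g' = hom_D[OF g]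
    have X: "X \<in> Obj K" using F.source.Dom_in[OF g'(1)] g' by simp
    have "is_coalgebra_map D R (ob F X) (p \<cdot>\<^bsub>D\<^esub> ar L g) B \<longleftrightarrow>
        b \<cdot>\<^bsub>D\<^esub> (p \<cdot>\<^bsub>D\<^esub> ar L g) = ar R (p \<cdot>\<^bsub>D\<^esub> ar L g) \<cdot>\<^bsub>D\<^esub> \<sigma> X"
      using g' p' by (simp add: coalg(2)[OF X] Bd is_coalgebra_map_def hom_def)
    also have "\<dots> \<longleftrightarrow> p2 \<cdot>\<^bsub>D\<^esub> ar L (s \<cdot>\<^bsub>K\<^esub> g) = p2 \<cdot>\<^bsub>D\<^esub> ar L (t \<cdot>\<^bsub>K\<^esub> g)"
      using s_post[OF g] t_post[OF g] by simp
    also have "\<dots> \<longleftrightarrow> s \<cdot>\<^bsub>K\<^esub> g = t \<cdot>\<^bsub>K\<^esub> g"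
      using couniversal_unique[OF L.cat_functor_axioms p2 F.source.Comp_in[OF g s(1)]
          F.source.Comp_in[OF g t(1)]] by auto
    finally show ?thesis .
  qed
  \<comment> \<open>The right adjoint sends \<open>B\<close> to \<open>E\<close>, with \<open>q\<close> as counit.\<close>
  define q where "q = (ob F E, p \<cdot>\<^bsub>D\<^esub> ar L i, B)"
  have q: "q \<in> hom (Cog D R) (ob F E) B"
    unfolding q_def hom_Cog using coalg(1)[OF E] B coalg_map[OF i'(1)] i'(2) by blast
  have q_post: "q \<cdot>\<^bsub>Cog D R\<^esub> ar F k = (ob F X, p \<cdot>\<^bsub>D\<^esub> ar L (i \<cdot>\<^bsub>K\<^esub> k), B)"
    if k: "k \<in> hom K X E" for k X
    using hom_D[OF k] it p' by (simp add: q_def F_ar[OF k] Comp_Cog)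
  have "couniversal K (Cog D R) F E q B"
  proof (rule couniversalI[OF E q])
    fix X f assume X: "X \<in> Obj K" and "f \<in> hom (Cog D R) (ob F X) B"
    then obtain f' where f: "f = (ob F X, f', B)" "is_coalgebra_map D R (ob F X) f' B"
      by (auto simp: hom_Cog)
    have "f' \<in> hom D (ob L X) Y" using is_coalgebra_mapD[OF f(2)] coalg(2)[OF X] Bd by simp
    then obtain g where g: "g \<in> hom K X U" "p \<cdot>\<^bsub>D\<^esub> ar L g = f'"
      using couniversal_factor[OF p X] by blast
    have "s \<cdot>\<^bsub>K\<^esub> g = t \<cdot>\<^bsub>K\<^esub> g" using coalg_map[OF g(1)] f g by simp
    then obtain k where "k \<in> hom K X E" "i \<cdot>\<^bsub>K\<^esub> k = g"
      using is_equaliser_factor[OF i, of g X] g st by (auto simp: E_def)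
    then show "\<exists>k. k \<in> hom K X E \<and> q \<cdot>\<^bsub>Cog D R\<^esub> ar F k = f" using q_post g f by auto
  next
    fix X k l assume k: "k \<in> hom K X E" and l: "l \<in> hom K X E"
      and "q \<cdot>\<^bsub>Cog D R\<^esub> ar F k = q \<cdot>\<^bsub>Cog D R\<^esub> ar F l"
    then have "p \<cdot>\<^bsub>D\<^esub> ar L (i \<cdot>\<^bsub>K\<^esub> k) = p \<cdot>\<^bsub>D\<^esub> ar L (i \<cdot>\<^bsub>K\<^esub> l)" using q_post by simp
    then have "i \<cdot>\<^bsub>K\<^esub> k = i \<cdot>\<^bsub>K\<^esub> l"
      by (rule couniversal_unique[OF L.cat_functor_axioms p F.source.Comp_in[OF k i'(1)]
          F.source.Comp_in[OF l i'(1)]])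
    then show "k = l"
      using is_equaliser_mono[OF F.source.category_axioms i, of k X l] k l by (simp add: E_def)
  qed
  then show "\<exists>U p. couniversal K (Cog D R) F U p B" by blast
qed

text \<open>If \<open>F'\<close> lifts \<open>F\<close>, then its underlying functor is \<open>F\<close> after the forgetful functor, which is a
  composite of two functors with right adjoints.\<close>

lemma lift_has_right_adjoint:
  assumes "comonad C Q" "comonad D R"
    and "has_coreflexive_equalisers C" "preserves_coreflexive_equalisers C C Q"
    and "cat_functor C D F" "has_right_adjoint C D F"
    and F': "cat_functor (Cog C Q) (Cog D R) F'"
    and ob: "\<And>A. A \<in> Obj (Cog C Q) \<Longrightarrow> ob forget (ob F' A) = ob F (ob forget A)"
    and ar: "\<And>f. f \<in> Arr (Cog C Q) \<Longrightarrow> ar forget (ar F' f) = ar F (ar forget f)"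
  shows "has_right_adjoint (Cog C Q) (Cog D R) F'"
proof (rule has_right_adjoint_into_Cog[OF assms(2) F'])
  show "has_coreflexive_equalisers (Cog C Q)"
    by (rule comonad.Cog_has_coreflexive_equalisers) fact+
  have "has_right_adjoint (Cog C Q) D (comp_func F forget)"
    by (rule has_right_adjoint_comp_func)
      (use assms comonad.cat_functor_forget comonad.forget_has_right_adjoint in blast)+
  then show "has_right_adjoint (Cog C Q) D (comp_func forget F')"
    by (rule has_right_adjoint_cong) (simp_all add: comp_func_def ob ar)
qed

section \<open>Adjunctions with a parameter\<close>

definition left_section ::
  "('o, 'm, 'x) cat_scheme \<Rightarrow> ('o \<times> 'p, 'm \<times> 'n, 'q, 'k, 'z) func_scheme \<Rightarrow> 'o
    \<Rightarrow> ('p, 'n, 'q, 'k) func" where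
  "left_section P F X = \<lparr>ob = (\<lambda>Y. ob F (X, Y)), ar = (\<lambda>g. ar F (Ident P X, g))\<rparr>"

definition swap_func ::
  "('o \<times> 'p, 'm \<times> 'n, 'q, 'k, 'z) func_scheme \<Rightarrow> ('p \<times> 'o, 'n \<times> 'm, 'q, 'k) func" where
  "swap_func F = \<lparr>ob = (\<lambda>(X, Y). ob F (Y, X)), ar = (\<lambda>(f, g). ar F (g, f))\<rparr>"

lemma bifunctor:
  assumes "cat_functor (prod_cat P A) B F"
  shows "\<lbrakk>X \<in> Obj P; Y \<in> Obj A\<rbrakk> \<Longrightarrow> ob F (X, Y) \<in> Obj B"
    and "\<lbrakk>f \<in> hom P X X'; g \<in> hom A Y Y'\<rbrakk> \<Longrightarrow> ar F (f, g) \<in> hom B (ob F (X, Y)) (ob F (X', Y'))"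
    and "\<lbrakk>X \<in> Obj P; Y \<in> Obj A\<rbrakk> \<Longrightarrow> ar F (Ident P X, Ident A Y) = Ident B (ob F (X, Y))"
    and "\<lbrakk>f \<in> hom P X X'; f' \<in> hom P X' X''; g \<in> hom A Y Y'; g' \<in> hom A Y' Y''\<rbrakk>
      \<Longrightarrow> ar F (f', g') \<cdot>\<^bsub>B\<^esub> ar F (f, g) = ar F (f' \<cdot>\<^bsub>P\<^esub> f, g' \<cdot>\<^bsub>A\<^esub> g)"
  using cat_functor.ob_in[OF assms, of "(X, Y)"] cat_functor.ar_in[OF assms, of "(f, g)" "(X, Y)" "(X', Y')"]
    cat_functor.ar_Ident[OF assms, of "(X, Y)"]
    cat_functor.ar_Comp[OF assms, of "(f, g)" "(X, Y)" "(X', Y')" "(f', g')" "(X'', Y'')"]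
  by (simp_all add: hom_prod_cat Comp_prod_cat Ident_prod_cat) (simp_all add: prod_cat_def)

lemma bifunctorI:
  assumes "category P" "category A" "category B"
    and "\<And>X Y. \<lbrakk>X \<in> Obj P; Y \<in> Obj A\<rbrakk> \<Longrightarrow> ob F (X, Y) \<in> Obj B"
    and "\<And>f g X X' Y Y'. \<lbrakk>f \<in> hom P X X'; g \<in> hom A Y Y'\<rbrakk>
      \<Longrightarrow> ar F (f, g) \<in> hom B (ob F (X, Y)) (ob F (X', Y'))"
    and "\<And>X Y. \<lbrakk>X \<in> Obj P; Y \<in> Obj A\<rbrakk> \<Longrightarrow> ar F (Ident P X, Ident A Y) = Ident B (ob F (X, Y))"
    and "\<And>f f' g g' X X' X'' Y Y' Y''.
      \<lbrakk>f \<in> hom P X X'; f' \<in> hom P X' X''; g \<in> hom A Y Y'; g' \<in> hom A Y' Y''\<rbrakk>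
      \<Longrightarrow> ar F (f' \<cdot>\<^bsub>P\<^esub> f, g' \<cdot>\<^bsub>A\<^esub> g) = ar F (f', g') \<cdot>\<^bsub>B\<^esub> ar F (f, g)"
  shows "cat_functor (prod_cat P A) B F"
proof (intro cat_functor.intro cat_functor_axioms.intro category_prod_cat assms(1-3))
  fix X assume "X \<in> Obj (prod_cat P A)"
  then show "ob F X \<in> Obj B" "ar F (Ident (prod_cat P A) X) = Ident B (ob F X)"
    using assms(4,6) by (auto simp: prod_cat_def)
next
  fix f X Y assume "f \<in> hom (prod_cat P A) X Y"
  then show "ar F f \<in> hom B (ob F X) (ob F Y)"
    using assms(5) by (cases f; cases X; cases Y) (auto simp: hom_prod_cat)
next
  fix f g X Y Z assume "f \<in> hom (prod_cat P A) X Y" "g \<in> hom (prod_cat P A) Y Z"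
  then show "ar F (g \<cdot>\<^bsub>prod_cat P A\<^esub> f) = ar F g \<cdot>\<^bsub>B\<^esub> ar F f"
    using assms(7) by (cases f; cases g; cases X; cases Y; cases Z) (auto simp: hom_prod_cat Comp_prod_cat)
qed

lemma cat_functor_swap_func:
  assumes "category P" "category A" and F: "cat_functor (prod_cat P A) B F"
  shows "cat_functor (prod_cat A P) B (swap_func F)"
  by (rule bifunctorI) (use assms bifunctor[OF F] in \<open>auto simp: swap_func_def cat_functor_def\<close>)

lemma cat_functor_left_section:
  assumes "category P" "category A" and F: "cat_functor (prod_cat P A) B F" and X: "X \<in> Obj P"
  shows "cat_functor A B (left_section P F X)"
proof -
  interpret P: category P by fact
  note I = P.Ident_in[OF X]
  show ?thesis
    using bifunctor(1,3)[OF F X] bifunctor(2)[OF F I] bifunctor(4)[OF F I I] P.Ident_left[OF I]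
      assms(1,2) cat_functor.axioms(2)[OF F]
    by (auto simp: cat_functor_def cat_functor_axioms_def left_section_def)
qed

lemma category_op_cat: "category C \<Longrightarrow> category (op_cat C)"
  unfolding category_def op_cat_def hom_def by auto

lemma hom_op_cat: "hom (op_cat C) X Y = hom C Y X"
  by (auto simp: hom_def op_cat_def)

text \<open>Adjunctions with a parameter: since the arrow \<open>e X Y : F (X, U X Y) \<rightarrow> Y\<close> is couniversal, there
  is exactly one way to make \<open>U\<close> a functor of both variables such that transposition is natural in
  all three. Naturality is proved first, since functoriality in composites is an instance of it.\<close>

lemma parametrised_right_adjoint:
  fixes A :: "('a, 'am, 'x) cat_scheme" and B :: "('b, 'bm, 'y) cat_scheme"
    and P :: "('p, 'pm, 'z) cat_scheme"
  assumes "category P" "category A" and F: "cat_functor (prod_cat P A) B F"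
    and adj: "\<And>X. X \<in> Obj P \<Longrightarrow> has_right_adjoint A B (left_section P F X)"
  obtains G :: "('p \<times> 'b, 'pm \<times> 'bm, 'a, 'am) func" and \<theta> :: "'p \<Rightarrow> 'a \<Rightarrow> 'b \<Rightarrow> 'bm \<Rightarrow> 'am"
  where "cat_functor (prod_cat (op_cat P) B) A G"
    and "\<And>X V Y. \<lbrakk>X \<in> Obj P; V \<in> Obj A; Y \<in> Obj B\<rbrakk>
      \<Longrightarrow> bij_betw (\<theta> X V Y) (hom B (ob F (X, V)) Y) (hom A V (ob G (X, Y)))"
    and "\<And>x v y X' X V' V Y Y' f.
      \<lbrakk>x \<in> hom P X' X; v \<in> hom A V' V; y \<in> hom B Y Y'; f \<in> hom B (ob F (X, V)) Y\<rbrakk>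
      \<Longrightarrow> \<theta> X' V' Y' (y \<cdot>\<^bsub>B\<^esub> f \<cdot>\<^bsub>B\<^esub> ar F (x, v)) = ar G (x, y) \<cdot>\<^bsub>A\<^esub> \<theta> X V Y f \<cdot>\<^bsub>A\<^esub> v"
proof -
  interpret P: category P by fact
  interpret A: category A by fact
  interpret B: category B using F by (simp add: cat_functor_def)
  note F_ob = bifunctor(1)[OF F] and F_ar = bifunctor(2)[OF F]
    and F_Ident = bifunctor(3)[OF F] and F_Comp = bifunctor(4)[OF F]
  obtain U e where couni: "couniversal A B (left_section P F X) (U X Y) (e X Y) Y"
    if "X \<in> Obj P" "Y \<in> Obj B" for X Y
    using adj unfolding has_right_adjoint_def by metis
  have U: "U X Y \<in> Obj A" and e: "e X Y \<in> hom B (ob F (X, U X Y)) Y"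
    and uni: "\<And>V f. \<lbrakk>V \<in> Obj A; f \<in> hom B (ob F (X, V)) Y\<rbrakk>
      \<Longrightarrow> \<exists>!g. g \<in> hom A V (U X Y) \<and> e X Y \<cdot>\<^bsub>B\<^esub> ar F (Ident P X, g) = f"
    if "X \<in> Obj P" "Y \<in> Obj B" for X Y
    using couni[OF that] by (auto simp: couniversal_def left_section_def)
  define \<theta> where "\<theta> X V Y f = (THE g. g \<in> hom A V (U X Y) \<and> e X Y \<cdot>\<^bsub>B\<^esub> ar F (Ident P X, g) = f)"
    for X V Y f
  have \<theta>: "\<theta> X V Y f \<in> hom A V (U X Y)" "e X Y \<cdot>\<^bsub>B\<^esub> ar F (Ident P X, \<theta> X V Y f) = f"
    if "X \<in> Obj P" "V \<in> Obj A" "Y \<in> Obj B" "f \<in> hom B (ob F (X, V)) Y" for X V Y f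
    using theI'[OF uni[OF that(1,3,2,4)]] by (simp_all add: \<theta>_def)
  have \<theta>_eqI: "\<theta> X V Y f = g" 
    if "X \<in> Obj P" "Y \<in> Obj B" "g \<in> hom A V (U X Y)" "e X Y \<cdot>\<^bsub>B\<^esub> ar F (Ident P X, g) = f" for X V Y f g
  proof -
    have V: "V \<in> Obj A" using A.Dom_in hom_D[OF that(3)] by auto
    have "f \<in> hom B (ob F (X, V)) Y"
      unfolding that(4)[symmetric]
      by (rule B.Comp_in[OF F_ar[OF P.Ident_in[OF that(1)] that(3)] e[OF that(1,2)]])
    then show ?thesis using \<theta>[OF that(1) V that(2)] uni[OF that(1,2) V] that(3,4) by blast
  qed
  \<comment> \<open>Naturality at the arrow \<open>e X Y\<close>, whose transpose is the identity, forces this value of \<open>G\<close> on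
    arrows.\<close>
  define G :: "('p \<times> 'b, 'pm \<times> 'bm, 'a, 'am) func" where
    "G = \<lparr>ob = (\<lambda>(X, Y). U X Y), ar = (\<lambda>(x, y). \<theta> (Dom P x) (U (Cod P x) (Dom B y)) (Cod B y)
       (y \<cdot>\<^bsub>B\<^esub> e (Cod P x) (Dom B y) \<cdot>\<^bsub>B\<^esub> ar F (x, Ident A (U (Cod P x) (Dom B y)))))\<rparr>"
  have G_ob: "ob G (X, Y) = U X Y" for X Y by (simp add: G_def)
  have G_ar: "ar G (x, y) = \<theta> X' (U X Y) Y' (y \<cdot>\<^bsub>B\<^esub> e X Y \<cdot>\<^bsub>B\<^esub> ar F (x, Ident A (U X Y)))"
    if "x \<in> hom P X' X" "y \<in> hom B Y Y'" for x y X X' Y Y'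
    using hom_D[OF that(1)] hom_D[OF that(2)] by (simp add: G_def)
  have obP: "X \<in> Obj P" "Y \<in> Obj P" if "f \<in> hom P X Y" for f X Y
    using that P.Dom_in P.Cod_in by (auto simp: hom_def)
  have obA: "X \<in> Obj A" "Y \<in> Obj A" if "f \<in> hom A X Y" for f X Y
    using that A.Dom_in A.Cod_in by (auto simp: hom_def)
  have obB: "X \<in> Obj B" "Y \<in> Obj B" if "f \<in> hom B X Y" for f X Y
    using that B.Dom_in B.Cod_in by (auto simp: hom_def)
  have G_arg: "y \<cdot>\<^bsub>B\<^esub> e X Y \<cdot>\<^bsub>B\<^esub> ar F (x, Ident A (U X Y)) \<in> hom B (ob F (X', U X Y)) Y'"
    if "x \<in> hom P X' X" "y \<in> hom B Y Y'" for x y X X' Y Y'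
    using B.Comp_in[OF B.Comp_in[OF F_ar[OF that(1) A.Ident_in] e] that(2)] U
      obP[OF that(1)] obB[OF that(2)] by blast
  have G_in: "ar G (x, y) \<in> hom A (U X Y) (U X' Y')"
    if "x \<in> hom P X' X" "y \<in> hom B Y Y'" for x y X X' Y Y'
    unfolding G_ar[OF that] using G_arg[OF that] U obP[OF that(1)] obB[OF that(2)] by (intro \<theta>) auto
  have natural: "\<theta> X' V' Y' (y \<cdot>\<^bsub>B\<^esub> f \<cdot>\<^bsub>B\<^esub> ar F (x, v)) = ar G (x, y) \<cdot>\<^bsub>A\<^esub> \<theta> X V Y f \<cdot>\<^bsub>A\<^esub> v"
    if x: "x \<in> hom P X' X" and v: "v \<in> hom A V' V" and y: "y \<in> hom B Y Y'"
      and f: "f \<in> hom B (ob F (X, V)) Y" for x v y X' X V' V Y Y' f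
  proof (rule \<theta>_eqI)
    show X': "X' \<in> Obj P" and Y': "Y' \<in> Obj B" using obP[OF x] obB[OF y] by auto
    have X: "X \<in> Obj P" and Y: "Y \<in> Obj B" and V: "V \<in> Obj A" and V': "V' \<in> Obj A"
      using obP[OF x] obB[OF y] obA[OF v] by auto
    let ?g = "\<theta> X V Y f"
    note g = \<theta>[OF X V Y f]
    note IX' = P.Ident_in[OF X'] and IX = P.Ident_in[OF X] and IU = A.Ident_in[OF U[OF X Y]]
    note gv = A.Comp_in[OF v g(1)]
    show "ar G (x, y) \<cdot>\<^bsub>A\<^esub> ?g \<cdot>\<^bsub>A\<^esub> v \<in> hom A V' (U X' Y')"
      by (rule A.Comp_in[OF gv G_in[OF x y]])
    have G: "e X' Y' \<cdot>\<^bsub>B\<^esub> ar F (Ident P X', ar G (x, y)) = y \<cdot>\<^bsub>B\<^esub> e X Y \<cdot>\<^bsub>B\<^esub> ar F (x, Ident A (U X Y))"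
      unfolding G_ar[OF x y] by (rule \<theta>(2)[OF X' U[OF X Y] Y' G_arg[OF x y]])
    have "e X' Y' \<cdot>\<^bsub>B\<^esub> ar F (Ident P X', ar G (x, y) \<cdot>\<^bsub>A\<^esub> ?g \<cdot>\<^bsub>A\<^esub> v)
      = e X' Y' \<cdot>\<^bsub>B\<^esub> ar F (Ident P X', ar G (x, y)) \<cdot>\<^bsub>B\<^esub> ar F (Ident P X', ?g \<cdot>\<^bsub>A\<^esub> v)"
      using F_Comp[OF IX' IX' gv G_in[OF x y]] P.Ident_left[OF IX'] by simp
    also have "\<dots> = (e X' Y' \<cdot>\<^bsub>B\<^esub> ar F (Ident P X', ar G (x, y))) \<cdot>\<^bsub>B\<^esub> ar F (Ident P X', ?g \<cdot>\<^bsub>A\<^esub> v)"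
      by (rule B.Comp_assoc[OF F_ar[OF IX' gv] F_ar[OF IX' G_in[OF x y]] e[OF X' Y'], symmetric])
    also have "\<dots> = y \<cdot>\<^bsub>B\<^esub> e X Y \<cdot>\<^bsub>B\<^esub> ar F (x, Ident A (U X Y)) \<cdot>\<^bsub>B\<^esub> ar F (Ident P X', ?g \<cdot>\<^bsub>A\<^esub> v)"
      unfolding G
      using hom_D[OF F_ar[OF IX' gv]] hom_D[OF F_ar[OF x IU]] hom_D[OF e[OF X Y]] hom_D[OF y]
      by (simp add: B.arrows)
    also have "ar F (x, Ident A (U X Y)) \<cdot>\<^bsub>B\<^esub> ar F (Ident P X', ?g \<cdot>\<^bsub>A\<^esub> v) = ar F (x, ?g \<cdot>\<^bsub>A\<^esub> v)"
      using F_Comp[OF IX' x gv IU] P.Ident_right[OF x] A.Ident_left[OF gv] by simp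
    also have "\<dots> = ar F (Ident P X, ?g) \<cdot>\<^bsub>B\<^esub> ar F (x, v)"
      using F_Comp[OF x IX v g(1)] P.Ident_left[OF x] by simp
    also have "e X Y \<cdot>\<^bsub>B\<^esub> \<dots> = (e X Y \<cdot>\<^bsub>B\<^esub> ar F (Ident P X, ?g)) \<cdot>\<^bsub>B\<^esub> ar F (x, v)"
      by (rule B.Comp_assoc[OF F_ar[OF x v] F_ar[OF IX g(1)] e[OF X Y], symmetric])
    also have "\<dots> = f \<cdot>\<^bsub>B\<^esub> ar F (x, v)" by (simp only: g(2))
    finally show "e X' Y' \<cdot>\<^bsub>B\<^esub> ar F (Ident P X', ar G (x, y) \<cdot>\<^bsub>A\<^esub> ?g \<cdot>\<^bsub>A\<^esub> v)
      = y \<cdot>\<^bsub>B\<^esub> f \<cdot>\<^bsub>B\<^esub> ar F (x, v)" .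
  qed
  show thesis
  proof (rule that)
    show "cat_functor (prod_cat (op_cat P) B) A G"
    proof (rule bifunctorI)
      show "category (op_cat P)" "category B" "category A"
        by (rule category_op_cat) unfold_locales
    next
      fix X Y assume "X \<in> Obj (op_cat P)" "Y \<in> Obj B"
      then have X: "X \<in> Obj P" and Y: "Y \<in> Obj B" by (simp_all add: op_cat_def)
      show "ob G (X, Y) \<in> Obj A" using U[OF X Y] by (simp add: G_ob)
      have "Ident B Y \<cdot>\<^bsub>B\<^esub> e X Y \<cdot>\<^bsub>B\<^esub> ar F (Ident P X, Ident A (U X Y))
        = e X Y \<cdot>\<^bsub>B\<^esub> ar F (Ident P X, Ident A (U X Y))"
        by (rule B.Ident_left[OF B.Comp_in[OF F_ar[OF P.Ident_in[OF X] A.Ident_in[OF U[OF X Y]]] e[OF X Y]]])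
      then have "ar G (Ident P X, Ident B Y) = Ident A (U X Y)"
        unfolding G_ar[OF P.Ident_in[OF X] B.Ident_in[OF Y]]
        by (intro \<theta>_eqI X Y A.Ident_in U) simp
      then show "ar G (Ident (op_cat P) X, Ident B Y) = Ident A (ob G (X, Y))"
        by (simp add: G_ob op_cat_def)
    next
      fix x y X X' Y Y' assume "x \<in> hom (op_cat P) X X'" "y \<in> hom B Y Y'"
      then show "ar G (x, y) \<in> hom A (ob G (X, Y)) (ob G (X', Y'))"
        using G_in by (simp add: hom_op_cat G_ob)
    next
      fix x x' y y' X X' X'' Y Y' Y''
      assume "x \<in> hom (op_cat P) X X'" "x' \<in> hom (op_cat P) X' X''"
        and y: "y \<in> hom B Y Y'" "y' \<in> hom B Y' Y''"
      then have x: "x \<in> hom P X' X" "x' \<in> hom P X'' X'" by (simp_all add: hom_op_cat)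
      have X: "X \<in> Obj P" and Y: "Y \<in> Obj B" using obP[OF x(1)] obB[OF y(1)] by auto
      note I = A.Ident_in[OF U[OF X Y]]
      let ?I = "Ident A (U X Y)"
      note xx = P.Comp_in[OF x(2,1)] and yy = B.Comp_in[OF y]
      note t = hom_D[OF F_ar[OF x(1) I]] hom_D[OF F_ar[OF x(2) I]] hom_D[OF e[OF X Y]]
        hom_D[OF y(1)] hom_D[OF y(2)]
      have "ar G (x \<cdot>\<^bsub>P\<^esub> x', y' \<cdot>\<^bsub>B\<^esub> y)
        = \<theta> X'' (U X Y) Y'' ((y' \<cdot>\<^bsub>B\<^esub> y) \<cdot>\<^bsub>B\<^esub> e X Y \<cdot>\<^bsub>B\<^esub> ar F (x \<cdot>\<^bsub>P\<^esub> x', ?I))"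
        by (rule G_ar[OF xx yy])
      also have "ar F (x \<cdot>\<^bsub>P\<^esub> x', ?I) = ar F (x, ?I) \<cdot>\<^bsub>B\<^esub> ar F (x', ?I)"
        using F_Comp[OF x(2,1) I I] A.Ident_left[OF I] by simp
      also have "(y' \<cdot>\<^bsub>B\<^esub> y) \<cdot>\<^bsub>B\<^esub> e X Y \<cdot>\<^bsub>B\<^esub> ar F (x, ?I) \<cdot>\<^bsub>B\<^esub> ar F (x', ?I)
        = y' \<cdot>\<^bsub>B\<^esub> (y \<cdot>\<^bsub>B\<^esub> e X Y \<cdot>\<^bsub>B\<^esub> ar F (x, ?I)) \<cdot>\<^bsub>B\<^esub> ar F (x', ?I)"
        using t by (simp add: B.arrows)
      also have "\<theta> X'' (U X Y) Y'' \<dots>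
        = ar G (x', y') \<cdot>\<^bsub>A\<^esub> \<theta> X' (U X Y) Y' (y \<cdot>\<^bsub>B\<^esub> e X Y \<cdot>\<^bsub>B\<^esub> ar F (x, ?I)) \<cdot>\<^bsub>A\<^esub> ?I"
        by (rule natural[OF x(2) I y(2) G_arg[OF x(1) y(1)]])
      also have "\<dots> = ar G (x', y') \<cdot>\<^bsub>A\<^esub> ar G (x, y)"
        using A.Ident_right[OF G_in[OF x(1) y(1)]] by (simp add: G_ar[OF x(1) y(1)])
      finally show "ar G (x' \<cdot>\<^bsub>op_cat P\<^esub> x, y' \<cdot>\<^bsub>B\<^esub> y) = ar G (x', y') \<cdot>\<^bsub>A\<^esub> ar G (x, y)"
        by (simp add: op_cat_def)
    qed
  next
    fix X V Y assume X: "X \<in> Obj P" and V: "V \<in> Obj A" and Y: "Y \<in> Obj B"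
    show "bij_betw (\<theta> X V Y) (hom B (ob F (X, V)) Y) (hom A V (ob G (X, Y)))"
    proof (rule bij_betw_byWitness[where f' = "\<lambda>g. e X Y \<cdot>\<^bsub>B\<^esub> ar F (Ident P X, g)"])
      show "\<forall>f\<in>hom B (ob F (X, V)) Y. e X Y \<cdot>\<^bsub>B\<^esub> ar F (Ident P X, \<theta> X V Y f) = f"
        using \<theta>[OF X V Y] by simp
      show "\<forall>g\<in>hom A V (ob G (X, Y)). \<theta> X V Y (e X Y \<cdot>\<^bsub>B\<^esub> ar F (Ident P X, g)) = g"
        using \<theta>_eqI[OF X Y] by (simp add: G_ob)
      show "\<theta> X V Y ` hom B (ob F (X, V)) Y \<subseteq> hom A V (ob G (X, Y))"
        using \<theta>[OF X V Y] by (auto simp: G_ob)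
      show "(\<lambda>g. e X Y \<cdot>\<^bsub>B\<^esub> ar F (Ident P X, g)) ` hom A V (ob G (X, Y)) \<subseteq> hom B (ob F (X, V)) Y"
        using B.Comp_in[OF F_ar[OF P.Ident_in[OF X]] e[OF X Y]] by (auto simp: G_ob)
    qed
  qed (rule natural)
qed

section \<open>Enrichment and cotensors as right adjoints\<close>

text \<open>Both functors come from adjunctions with a parameter, \<open>{X, Y}\<close> with parameter \<open>X\<close> and
  \<open>\<langle>Y, V\<rangle>\<close> with parameter \<open>V\<close>. The bijection between maps into them is the composite through
  the maps \<open>V \<boxtimes> X \<rightarrow> Y\<close>.\<close>

lemma enriched_tensored_cotensored_if_right_adjoints:
  fixes E :: "('o, 'm, 'x) moncat_scheme" and D :: "('p, 'n, 'y) cat_scheme"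
    and T :: "('o, 'm, 'p, 'n, 'z) tensn_scheme"
  assumes "tensorisation E D T"
    and adj_E: "\<And>X. X \<in> Obj D \<Longrightarrow> has_right_adjoint E D (left_section D (swap_func T) X)"
    and adj_D: "\<And>V. V \<in> Obj E \<Longrightarrow> has_right_adjoint D D (left_section E T V)"
  shows "\<exists>(H :: ('p \<times> 'p, 'n \<times> 'n, 'o, 'm) func) (P :: ('p \<times> 'o, 'n \<times> 'm, 'p, 'n) func) \<phi> \<psi>.
    enriched_tensored_cotensored E D T H P \<phi> \<psi>"
proof -
  interpret tensorisation E D T by fact
  have cE: "category E" and cD: "category D" by unfold_locales
  note T = act.cat_functor_axioms
  obtain H :: "('p \<times> 'p, 'n \<times> 'n, 'o, 'm) func" and \<theta>
    where H: "cat_functor (prod_cat (op_cat D) D) E H"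
    and \<theta>: "\<And>X V Y. \<lbrakk>X \<in> Obj D; V \<in> Obj E; Y \<in> Obj D\<rbrakk>
      \<Longrightarrow> bij_betw (\<theta> X V Y) (hom D (ob (swap_func T) (X, V)) Y) (hom E V (ob H (X, Y)))"
    and \<theta>_nat: "\<And>x v y X' X V' V Y Y' f.
      \<lbrakk>x \<in> hom D X' X; v \<in> hom E V' V; y \<in> hom D Y Y'; f \<in> hom D (ob (swap_func T) (X, V)) Y\<rbrakk>
      \<Longrightarrow> \<theta> X' V' Y' (y \<cdot>\<^bsub>D\<^esub> f \<cdot>\<^bsub>D\<^esub> ar (swap_func T) (x, v)) = ar H (x, y) \<cdot>\<^bsub>E\<^esub> \<theta> X V Y f \<cdot>\<^bsub>E\<^esub> v"
    using parametrised_right_adjoint[OF cD cE cat_functor_swap_func[OF cE cD T] adj_E] by blast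
  obtain G :: "('o \<times> 'p, 'm \<times> 'n, 'p, 'n) func" and \<chi>
    where G: "cat_functor (prod_cat (op_cat E) D) D G"
    and \<chi>: "\<And>V X Y. \<lbrakk>V \<in> Obj E; X \<in> Obj D; Y \<in> Obj D\<rbrakk>
      \<Longrightarrow> bij_betw (\<chi> V X Y) (hom D (ob T (V, X)) Y) (hom D X (ob G (V, Y)))"
    and \<chi>_nat: "\<And>v x y V' V X' X Y Y' f.
      \<lbrakk>v \<in> hom E V' V; x \<in> hom D X' X; y \<in> hom D Y Y'; f \<in> hom D (ob T (V, X)) Y\<rbrakk>
      \<Longrightarrow> \<chi> V' X' Y' (y \<cdot>\<^bsub>D\<^esub> f \<cdot>\<^bsub>D\<^esub> ar T (v, x)) = ar G (v, y) \<cdot>\<^bsub>D\<^esub> \<chi> V X Y f \<cdot>\<^bsub>D\<^esub> x"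
    using parametrised_right_adjoint[OF cE cD T adj_D] by blast
  define \<phi> where "\<phi> V X Y f = \<theta> X V Y f" for V X Y f
  define \<phi>i where "\<phi>i V X Y = inv_into (hom D (ob T (V, X)) Y) (\<phi> V X Y)" for V X Y
  define \<psi> where "\<psi> V X Y h = \<chi> V X Y (\<phi>i V X Y h)" for V X Y h
  define P where "P = swap_func G"
  have \<phi>: "bij_betw (\<phi> V X Y) (hom D (ob T (V, X)) Y) (hom E V (ob H (X, Y)))"
    if "V \<in> Obj E" "X \<in> Obj D" "Y \<in> Obj D" for V X Y
    using \<theta>[OF that(2,1,3)] by (simp add: \<phi>_def[abs_def] swap_func_def)
  have \<phi>_nat: "\<phi> V' X' Y' (y \<cdot>\<^bsub>D\<^esub> f \<cdot>\<^bsub>D\<^esub> ar T (v, x)) = ar H (x, y) \<cdot>\<^bsub>E\<^esub> \<phi> V X Y f \<cdot>\<^bsub>E\<^esub> v"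
    if "v \<in> hom E V' V" "x \<in> hom D X' X" "y \<in> hom D Y Y'" "f \<in> hom D (ob T (V, X)) Y"
    for v x y V V' X X' Y Y' f
    using \<theta>_nat[OF that(2,1,3)] that(4) by (simp add: \<phi>_def swap_func_def)
  have \<psi>: "bij_betw (\<psi> V X Y) (hom E V (ob H (X, Y))) (hom D X (ob P (Y, V)))"
    if V: "V \<in> Obj E" "X \<in> Obj D" "Y \<in> Obj D" for V X Y
    using bij_betw_trans[OF bij_betw_inv_into[OF \<phi>[OF V]] \<chi>[OF V]]
    by (simp add: \<psi>_def[abs_def] \<phi>i_def comp_def P_def swap_func_def)
  have \<psi>_nat: "\<psi> V' X' Y' (ar H (x, y) \<cdot>\<^bsub>E\<^esub> h \<cdot>\<^bsub>E\<^esub> v) = ar P (y, v) \<cdot>\<^bsub>D\<^esub> \<psi> V X Y h \<cdot>\<^bsub>D\<^esub> x"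
    if v: "v \<in> hom E V' V" and x: "x \<in> hom D X' X" and y: "y \<in> hom D Y Y'"
      and h: "h \<in> hom E V (ob H (X, Y))" for v x y V V' X X' Y Y' h
  proof -
    have obs: "V \<in> Obj E" "V' \<in> Obj E" "X \<in> Obj D" "X' \<in> Obj D" "Y \<in> Obj D" "Y' \<in> Obj D"
      using hom_D[OF v] hom_D[OF x] hom_D[OF y] mon.Dom_in mon.Cod_in cat.Dom_in cat.Cod_in by auto
    let ?f = "\<phi>i V X Y h"
    have f: "?f \<in> hom D (ob T (V, X)) Y" "\<phi> V X Y ?f = h"
      using bij_betw_inv_into[OF \<phi>[OF obs(1,3,5)]] bij_betw_inv_into_right[OF \<phi>[OF obs(1,3,5)] h] h
      by (auto simp: \<phi>i_def bij_betw_def)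
    have "y \<cdot>\<^bsub>D\<^esub> ?f \<cdot>\<^bsub>D\<^esub> ar T (v, x) \<in> hom D (ob T (V', X')) Y'"
      by (rule cat.Comp_in[OF cat.Comp_in[OF bifunctor(2)[OF T v x] f(1)] y])
    then have "\<phi>i V' X' Y' (ar H (x, y) \<cdot>\<^bsub>E\<^esub> h \<cdot>\<^bsub>E\<^esub> v) = y \<cdot>\<^bsub>D\<^esub> ?f \<cdot>\<^bsub>D\<^esub> ar T (v, x)"
      unfolding \<phi>i_def[of V' X' Y']
      using \<phi>_nat[OF v x y f(1)] f(2) bij_betw_inv_into_left[OF \<phi>[OF obs(2,4,6)]] by metis
    then show ?thesis using \<chi>_nat[OF v x y f(1)] by (simp add: \<psi>_def P_def swap_func_def)
  qed
  have "cat_functor (prod_cat D (op_cat E)) D P"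
    unfolding P_def by (rule cat_functor_swap_func[OF category_op_cat[OF cE] cD G])
  then have "enriched_tensored_cotensored E D T H P \<phi> \<psi>"
    using \<open>tensorisation E D T\<close> H \<phi> \<phi>_nat \<psi> \<psi>_nat
    by (simp add: enriched_tensored_cotensored_def enriched_tensored_cotensored_axioms_def)
  then show ?thesis by blast
qed

context enriched_tensored_cotensored begin

lemma tensor_left_has_right_adjoint:
  assumes X: "X \<in> Obj D" shows "has_right_adjoint E D (left_section D (swap_func T) X)"
proof (rule natural_bij_has_right_adjoint[where U = "\<lambda>Y. ob H (X, Y)" and \<theta> = "\<lambda>V Y. \<phi> V X Y"])
  have cE: "category E" and cD: "category D" by unfold_locales
  show "cat_functor E D (left_section D (swap_func T) X)"
    by (rule cat_functor_left_section[OF cD cE cat_functor_swap_func[OF cE cD act.cat_functor_axioms] X])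
  note I = cat.Ident_in[OF X]
  show "ob H (X, Y) \<in> Obj E" if "Y \<in> Obj D" for Y
    using bifunctor(1)[OF enrich.cat_functor_axioms _ that] X by (simp add: op_cat_def)
  show "bij_betw (\<phi> V X Y) (hom D (ob (left_section D (swap_func T) X) V) Y) (hom E V (ob H (X, Y)))"
    if "V \<in> Obj E" "Y \<in> Obj D" for V Y
    using enrich_bij[OF that(1) X that(2)] by (simp add: left_section_def swap_func_def)
  show "\<phi> V' X Y (f \<cdot> ar (left_section D (swap_func T) X) v) = \<phi> V X Y f \<cdot>\<^bsub>E\<^esub> v"
    if v: "v \<in> hom E V' V" and Y: "Y \<in> Obj D" and f: "f \<in> hom D (ob (left_section D (swap_func T) X) V) Y"
    for v V' V Y f
  proof -
    have V: "V \<in> Obj E" using v mon.Cod_in by (auto simp: hom_def)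
    have f': "f \<in> hom D (ob T (V, X)) Y" using f by (simp add: left_section_def swap_func_def)
    have g: "\<phi> V X Y f \<cdot>\<^bsub>E\<^esub> v \<in> hom E V' (ob H (X, Y))"
      using enrich_bij[OF V X Y] f' mon.Comp_in[OF v] by (auto simp: bij_betw_def)
    have "\<phi> V' X Y (Ident D Y \<cdot> f \<cdot> ar T (v, Ident D X))
      = ar H (Ident D X, Ident D Y) \<cdot>\<^bsub>E\<^esub> \<phi> V X Y f \<cdot>\<^bsub>E\<^esub> v"
      by (rule enrich_natural[OF v I cat.Ident_in[OF Y] f'])
    moreover have "ar H (Ident D X, Ident D Y) = Ident E (ob H (X, Y))"
      using bifunctor(3)[OF enrich.cat_functor_axioms, of X Y] X Y by (simp add: op_cat_def)
    ultimately show ?thesis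
      using cat.Ident_left[OF cat.Comp_in[OF bifunctor(2)[OF act.cat_functor_axioms v I] f']]
        mon.Ident_left[OF g] by (simp add: left_section_def swap_func_def)
  qed
qed

lemma tensor_right_has_right_adjoint:
  assumes V: "V \<in> Obj E" shows "has_right_adjoint D D (left_section E T V)"
proof (rule natural_bij_has_right_adjoint[where U = "\<lambda>Y. ob P (Y, V)"
      and \<theta> = "\<lambda>X Y f. \<psi> V X Y (\<phi> V X Y f)"])
  have cE: "category E" and cD: "category D" by unfold_locales
  show "cat_functor D D (left_section E T V)"
    by (rule cat_functor_left_section[OF cE cD act.cat_functor_axioms V])
  note I = mon.Ident_in[OF V]
  show "ob P (Y, V) \<in> Obj D" if "Y \<in> Obj D" for Y
    using bifunctor(1)[OF cotens.cat_functor_axioms that] V by (simp add: op_cat_def)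
  show "bij_betw (\<lambda>f. \<psi> V X Y (\<phi> V X Y f)) (hom D (ob (left_section E T V) X) Y) (hom D X (ob P (Y, V)))"
    if "X \<in> Obj D" "Y \<in> Obj D" for X Y
    using bij_betw_trans[OF enrich_bij[OF V that] cotens_bij[OF V that]]
    by (simp add: left_section_def comp_def)
  show "\<psi> V X' Y (\<phi> V X' Y (f \<cdot> ar (left_section E T V) x)) = \<psi> V X Y (\<phi> V X Y f) \<cdot> x"
    if x: "x \<in> hom D X' X" and Y: "Y \<in> Obj D" and f: "f \<in> hom D (ob (left_section E T V) X) Y"
    for x X' X Y f
  proof -
    have X: "X \<in> Obj D" using x cat.Cod_in by (auto simp: hom_def)
    have f': "f \<in> hom D (ob T (V, X)) Y" using f by (simp add: left_section_def)
    have h: "\<phi> V X Y f \<in> hom E V (ob H (X, Y))"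
      using enrich_bij[OF V X Y] f' by (auto simp: bij_betw_def)
    have k: "\<psi> V X Y (\<phi> V X Y f) \<cdot> x \<in> hom D X' (ob P (Y, V))"
      using cotens_bij[OF V X Y] h cat.Comp_in[OF x] by (auto simp: bij_betw_def)
    note IY = cat.Ident_in[OF Y]
    have "\<psi> V X' Y (\<phi> V X' Y (f \<cdot> ar T (Ident E V, x)))
      = \<psi> V X' Y (\<phi> V X' Y (Ident D Y \<cdot> f \<cdot> ar T (Ident E V, x)))"
      using cat.Ident_left[OF cat.Comp_in[OF bifunctor(2)[OF act.cat_functor_axioms I x] f']] by simp
    also have "\<dots> = \<psi> V X' Y (ar H (x, Ident D Y) \<cdot>\<^bsub>E\<^esub> \<phi> V X Y f \<cdot>\<^bsub>E\<^esub> Ident E V)"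
      by (simp only: enrich_natural[OF I x IY f'])
    also have "\<dots> = ar P (Ident D Y, Ident E V) \<cdot> \<psi> V X Y (\<phi> V X Y f) \<cdot> x"
      by (rule cotens_natural[OF I x IY h])
    also have "ar P (Ident D Y, Ident E V) = Ident D (ob P (Y, V))"
      using bifunctor(3)[OF cotens.cat_functor_axioms, of Y V] V Y by (simp add: op_cat_def)
    finally show ?thesis using cat.Ident_left[OF k] by (simp add: left_section_def)
  qed
qed

end

text \<open>Functors and couniversal arrows are determined by objects, arrows, identities and composition,
  which \<open>Cog_mon C Q\<close> shares with \<open>Cog C Q\<close>.\<close>

lemma cat_functor_Cog_monD:
  "\<lbrakk>comonad C Q; cat_functor (Cog_mon C Q) B F\<rbrakk> \<Longrightarrow> cat_functor (Cog C Q) B F"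
  by (simp add: cat_functor_def cat_functor_axioms_def Cog_mon_sel hom_Cog_mon comonad.category_Cog)

lemma has_right_adjoint_Cog_mon:
  "has_right_adjoint (Cog_mon C Q) B F \<longleftrightarrow> has_right_adjoint (Cog C Q) B F"
  by (simp add: has_right_adjoint_def couniversal_def Cog_mon_sel hom_Cog_mon)

theorem theorem5:
  fixes C :: "('oc, 'mc) moncat" and D :: "('od, 'md) cat"
    and T :: "('oc, 'mc, 'od, 'md) tensn"
    and H :: "('od \<times> 'od, 'md \<times> 'md, 'oc, 'mc) func"
    and P :: "('od \<times> 'oc, 'md \<times> 'mc, 'od, 'md) func"
    and \<phi> :: "'oc \<Rightarrow> 'od \<Rightarrow> 'od \<Rightarrow> 'md \<Rightarrow> 'mc"
    and \<psi> :: "'oc \<Rightarrow> 'od \<Rightarrow> 'od \<Rightarrow> 'mc \<Rightarrow> 'md"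
    and Q :: "('oc, 'mc) hopf_comnd" and R :: "('od, 'md) comnd"
    and T' :: "('oc \<times> 'mc, ('oc, 'mc) coalg_arr, 'od \<times> 'md, ('od, 'md) coalg_arr) tensn"
  assumes "monoidal_category C"
    and "has_coreflexive_equalisers C"
    and "category D"
    and "enriched_tensored_cotensored C D T H P \<phi> \<psi>"
    and "has_coreflexive_equalisers D"
    and "has_reflexive_coequalisers D"
    and "hopf_comonad C Q"
    and "preserves_coreflexive_equalisers C C Q"
    and "comonad D R"
    and "preserves_coreflexive_equalisers D D R"
    and "tensorisation (Cog_mon C Q) (Cog D R) T'"
    and "lifts_tensorisation C D Q R T T'"
  shows "\<exists>(H' :: (('od \<times> 'md) \<times> ('od \<times> 'md), ('od, 'md) coalg_arr \<times> ('od, 'md) coalg_arr,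
                   'oc \<times> 'mc, ('oc, 'mc) coalg_arr) func)
          (P' :: (('od \<times> 'md) \<times> ('oc \<times> 'mc), ('od, 'md) coalg_arr \<times> ('oc, 'mc) coalg_arr,
                   'od \<times> 'md, ('od, 'md) coalg_arr) func)
          \<phi>' \<psi>'.
           enriched_tensored_cotensored (Cog_mon C Q) (Cog D R) T' H' P' \<phi>' \<psi>'"
proof (rule enriched_tensored_cotensored_if_right_adjoints)
  show T': "tensorisation (Cog_mon C Q) (Cog D R) T'" by fact
  interpret T: enriched_tensored_cotensored C D T H P \<phi> \<psi> by fact
  interpret T': tensorisation "Cog_mon C Q" "Cog D R" T' by fact
  have Q: "comonad C Q" using assms(7) by (simp add: hopf_comonad_def)
  have R: "comonad D R" by fact
  have cC: "category C" and cD: "category D" and cQ: "category (Cog_mon C Q)" and cR: "category (Cog D R)"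
    by unfold_locales
  note Tf = T.act.cat_functor_axioms and Tf' = T'.act.cat_functor_axioms
  have lift_ob: "ob forget (ob T' (A, X)) = ob T (ob forget A, ob forget X)"
    if "A \<in> Obj (Cog C Q)" "X \<in> Obj (Cog D R)" for A X
    using assms(12) that by (simp add: lifts_tensorisation_def)
  have lift_ar: "ar forget (ar T' (f, x)) = ar T (ar forget f, ar forget x)"
    if "f \<in> Arr (Cog C Q)" "x \<in> Arr (Cog D R)" for f x
    using assms(12) that by (simp add: lifts_tensorisation_def)
  have forget_Ident: "ar forget (Ident (Cog K S) A) = Ident K (ob forget A)"
    for K :: "('a, 'b, 'x) cat_scheme" and S :: "('a, 'b, 'y) comnd_scheme" and A
    by (simp add: forget_def Cog_sel)
  show "has_right_adjoint (Cog_mon C Q) (Cog D R) (left_section (Cog D R) (swap_func T') X)"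
    if X: "X \<in> Obj (Cog D R)" for X
    unfolding has_right_adjoint_Cog_mon
  proof (rule lift_has_right_adjoint[OF Q R assms(2,8)])
    have X0: "ob forget X \<in> Obj D" using X by (auto simp: Cog_sel forget_def dest: is_coalgebraD)
    show "cat_functor C D (left_section D (swap_func T) (ob forget X))"
      by (rule cat_functor_left_section[OF cD cC cat_functor_swap_func[OF cC cD Tf] X0])
    show "has_right_adjoint C D (left_section D (swap_func T) (ob forget X))"
      by (rule T.tensor_left_has_right_adjoint[OF X0])
    show "cat_functor (Cog C Q) (Cog D R) (left_section (Cog D R) (swap_func T') X)"
      by (intro cat_functor_Cog_monD[OF Q]
          cat_functor_left_section[OF cR cQ cat_functor_swap_func[OF cQ cR Tf'] X])
  qed (use X T'.cat.Ident_Arr in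
      \<open>simp_all add: left_section_def swap_func_def lift_ob lift_ar forget_Ident\<close>)
  show "has_right_adjoint (Cog D R) (Cog D R) (left_section (Cog_mon C Q) T' A)"
    if "A \<in> Obj (Cog_mon C Q)" for A
  proof (rule lift_has_right_adjoint[OF R R assms(5,10)])
    have A: "A \<in> Obj (Cog C Q)" using that by (simp add: Cog_mon_sel)
    have A0: "ob forget A \<in> Obj C" using A by (auto simp: Cog_sel forget_def dest: is_coalgebraD)
    have "Ident (Cog C Q) A \<in> Arr (Cog C Q)"
      using T'.mon.Ident_Arr[OF that] by (simp add: Cog_mon_sel)
    then show "ob forget (ob (left_section (Cog_mon C Q) T' A) X)
        = ob (left_section C T (ob forget A)) (ob forget X)" if "X \<in> Obj (Cog D R)" for X
      using that A by (simp add: left_section_def lift_ob)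
    show "ar forget (ar (left_section (Cog_mon C Q) T' A) x)
        = ar (left_section C T (ob forget A)) (ar forget x)" if "x \<in> Arr (Cog D R)" for x
      using that \<open>Ident (Cog C Q) A \<in> Arr (Cog C Q)\<close>
      by (simp add: left_section_def lift_ar forget_Ident Cog_mon_sel)
    show "cat_functor D D (left_section C T (ob forget A))"
      by (rule cat_functor_left_section[OF cC cD Tf A0])
    show "has_right_adjoint D D (left_section C T (ob forget A))"
      by (rule T.tensor_right_has_right_adjoint[OF A0])
    show "cat_functor (Cog D R) (Cog D R) (left_section (Cog_mon C Q) T' A)"
      by (rule cat_functor_left_section[OF cQ cR Tf' that])
  qed
qed

end
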